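(* Let $\mu\in(0,1)$ and $c_J=-1-2\sqrt{\mu(1-\mu)}$. The doubly-covered elliptic coordinates $(\lambda,\nu,p_\lambda,p_\nu)\mapsto(q_1,q_2,p_1,p_2)$ give a 2-to-1 symplectic map (away from collisions with $E$ and $M$), and for $c<c_J$ the regularized Earth component $\overline{\Sigma}{}_c^E\subset Q_c^{-1}(0)$, viewed as a closed hypersurface in $\mathbb{R}^4$ with coordinates $(\lambda,\nu,p_\lambda,p_\nu)$, satisfies the following. (i) If $\mu\ge 1/2$, then $\overline{\Sigma}{}_c^E$ is convex for every $c<c_J$. (ii) If $\mu<1/2$, then there exists $c_0=c_0(\mu)<c_J$ such that $\overline{\Sigma}{}_c^E$ is convex for every $c<c_0$ and is not convex for every $c$ with $c_0\le c<c_J$.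
   Context: Euler problem of two fixed centers: place the Earth and the Moon at $E=(-1/2,0)$ and $M=(1/2,0)$. For $\mu\in(0,1)$ the Hamiltonian is $H(q,p)=\frac12|p|^2-\frac{1-\mu}{|q-E|}-\frac{\mu}{|q-M|}$ on $(\mathbb{R}^2\setminus\{E,M\})\times\mathbb{R}^2$. Its only critical value is the critical Jacobi energy $c_J=-1-2\sqrt{\mu(1-\mu)}$. For $c<c_J$, $H^{-1}(c)$ consists of two bounded components, the Earth component $\Sigma_c^E$ and the Moon component $\Sigma_c^M$, whose projections to the $q$-plane are near $E$ and $M$ respectively. Doubly-covered elliptic coordinates $(\lambda,\nu)\in\mathbb{R}\times(\mathbb{R}/2\pi\mathbb{Z})$ are given by $q_1=\frac12\cosh\lambda\cos\nu$, $q_2=\frac12\sinh\lambda\sin\nu$ (so $\cosh\lambda=|q-E|+|q-M|$ and $\cos\nu=|q-E|-|q-M|$), with momenta determined by $p_\lambda d\lambda+p_\nu d\nu=p_1dq_1+p_2dq_2$. The regularized Hamiltonian is $$Q_c=(H-c)(\cosh^2\lambda-\cos^2\nu)=2p_\lambda^2-2\cosh\lambda-c\cosh^2\lambda+2p_\nu^2+2(1-2\mu)\cos\nu+c\cos^2\nu .$$ For $c<c_J$ the regularized Earth component $\overline{\Sigma}{}_c^E$ is the connected component of $Q_c^{-1}(0)$ whose projection to the $(\lambda,\nu)$-cylinder contains $(0,\pi)$ (the point corresponding to $E$). It lies in the region $0<\nu<2\pi$ and is therefore regarded as a closed hypersurface (diffeomorphic to $S^3$) in $\mathbb{R}^4$.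 "Convex" means strictly convex: the hypersurface bounds a strictly convex domain in $\mathbb{R}^4$, in the sense that its second fundamental form (with respect to the suitable unit normal) is positive definite at every point. Equivalently, for a mechanical Hamiltonian $\frac12|p|^2+V(x,y)$ and a closed regular component $S$ (homeomorphic to $S^3$) of the level set at level $h$, one has $2(h-V)(V_{xx}V_{yy}-V_{xy}^2)+V_{xx}V_y^2+V_{yy}V_x^2-2V_xV_yV_{xy}>0$ at all points of the projection of $S$ to the $(x,y)$-plane; here this is applied to $Q_c/4$ (up to a constant factor on momenta). *)

theory Defs
  imports "HOL-Analysis.Analysis"
begin

type_synonym plane = "real \<times> real"

(* A point of phase space is a pair (position, momentum); as a Euclidean space this is R^4. *)
type_synonym phase = "plane \<times> plane"

definition tangent_space :: "'a::euclidean_space set \<Rightarrow> 'a \<Rightarrow> 'a set" where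
  "tangent_space S x =
     {v. \<exists>\<gamma>::real \<Rightarrow> 'a. \<gamma> 0 = x \<and> (\<forall>\<^sub>F t in nhds 0. \<gamma> t \<in> S) \<and>
          (\<gamma> has_vector_derivative v) (at 0)}"

(* Locally a regular level set of a twice continuously differentiable function rho,
   with gradient g and Hessian g'. *)
definition C2_hypersurface :: "'a::euclidean_space set \<Rightarrow> bool" where
  "C2_hypersurface S \<longleftrightarrow>
     (\<forall>x\<in>S. \<exists>U (\<rho> :: 'a \<Rightarrow> real) (g :: 'a \<Rightarrow> 'a) (g' :: 'a \<Rightarrow> 'a \<Rightarrow>\<^sub>L 'a).
        open U \<and> x \<in> U \<and> S \<inter> U = {y \<in> U. \<rho> y = 0} \<and>
        (\<forall>y\<in>U. GDERIV \<rho> y :> g y \<and> g y \<noteq> 0 \<and>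
                (g has_derivative blinfun_apply (g' y)) (at y)) \<and>
        continuous_on U g')"

definition closed_hypersurface :: "'a::euclidean_space set \<Rightarrow> bool" where
  "closed_hypersurface S \<longleftrightarrow> S \<noteq> {} \<and> compact S \<and> connected S \<and> C2_hypersurface S"

(* The field N is given on the ambient space so that it can be differentiated; only its
   derivatives in directions tangent to S are used, and these depend on N restricted to S only. *)
definition unit_normal_field :: "'a::euclidean_space set \<Rightarrow> ('a \<Rightarrow> 'a) \<Rightarrow> bool" where
  "unit_normal_field S N \<longleftrightarrow>
     (\<forall>x\<in>S. N differentiable (at x) \<and> norm (N x) = 1 \<and>
             (\<forall>v\<in>tangent_space S x. N x \<bullet> v = 0))"

(* Shape operator convention: the unit sphere has positive definite second fundamental form
   with respect to its inward normal N x = - x. *)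
definition second_fundamental_form ::
    "('a::euclidean_space \<Rightarrow> 'a) \<Rightarrow> 'a \<Rightarrow> 'a \<Rightarrow> 'a \<Rightarrow> real" where
  "second_fundamental_form N x v w = - (frechet_derivative N (at x) v \<bullet> w)"

definition strictly_convex_hypersurface :: "'a::euclidean_space set \<Rightarrow> bool" where
  "strictly_convex_hypersurface S \<longleftrightarrow>
     closed_hypersurface S \<and>
     (\<exists>D. open D \<and> connected D \<and> bounded D \<and> frontier D = S) \<and>
     (\<exists>N. unit_normal_field S N \<and>
          (\<forall>x\<in>S. \<forall>v\<in>tangent_space S x. v \<noteq> 0 \<longrightarrow> second_fundamental_form N x v v > 0))"

definition symplectic_form :: "phase \<Rightarrow> phase \<Rightarrow> real" where
  "symplectic_form u v = fst u \<bullet> snd v - snd u \<bullet> fst v"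

definition symplectic_on :: "phase set \<Rightarrow> (phase \<Rightarrow> phase) \<Rightarrow> bool" where
  "symplectic_on X f \<longleftrightarrow>
     (\<exists>f' :: phase \<Rightarrow> phase \<Rightarrow>\<^sub>L phase.
        continuous_on X f' \<and>
        (\<forall>x\<in>X. (f has_derivative blinfun_apply (f' x)) (at x) \<and>
           (\<forall>u v. symplectic_form (f' x u) (f' x v) = symplectic_form u v)))"

definition earth :: plane where "earth = (- 1/2, 0)"
definition moon :: plane where "moon = (1/2, 0)"

definition euler_H :: "real \<Rightarrow> phase \<Rightarrow> real" where
  "euler_H \<mu> = (\<lambda>(q, p). (norm p)\<^sup>2 / 2 - (1 - \<mu>) / norm (q - earth) - \<mu> / norm (q - moon))"

definition critical_energy :: "real \<Rightarrow> real" where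
  "critical_energy \<mu> = - 1 - 2 * sqrt (\<mu> * (1 - \<mu>))"

definition elliptic_q :: "plane \<Rightarrow> plane" where
  "elliptic_q = (\<lambda>(l, n). (cosh l * cos n / 2, sinh l * sin n / 2))"

(* The coordinates are written with a real angle; the quotient by 2 pi Z is taken by wrap below.
   The momentum p is the covector with P . v = p . dq(v), that is
   p_lambda dlambda + p_nu dnu = p_1 dq_1 + p_2 dq_2. *)
definition elliptic_coords :: "phase \<Rightarrow> phase" where
  "elliptic_coords = (\<lambda>(x, P).
     (elliptic_q x, THE p. \<forall>v. P \<bullet> v = p \<bullet> frechet_derivative elliptic_q (at x) v))"

definition noncollision :: "phase set" where
  "noncollision = {(q, p). q \<noteq> earth \<and> q \<noteq> moon}"

definition elliptic_domain :: "phase set" where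
  "elliptic_domain = {(x, P). elliptic_q x \<noteq> earth \<and> elliptic_q x \<noteq> moon}"

(* R / 2 pi Z is realised as the unit circle of the complex plane. *)
definition wrap :: "phase \<Rightarrow> (real \<times> complex) \<times> plane" where
  "wrap = (\<lambda>((l, n), P). ((l, cis n), P))"

(* f is defined in terms of a real angle, descends to the angle modulo 2 pi, and every point
   of Y has exactly two preimages modulo 2 pi. *)
definition two_to_one_mod_2pi :: "phase set \<Rightarrow> phase set \<Rightarrow> (phase \<Rightarrow> phase) \<Rightarrow> bool" where
  "two_to_one_mod_2pi X Y f \<longleftrightarrow>
     (\<forall>x\<in>X. \<forall>y\<in>X. wrap x = wrap y \<longrightarrow> f x = f y) \<and>
     f ` X \<subseteq> Y \<and>
     (\<forall>y\<in>Y. card (wrap ` {x \<in> X. f x = y}) = 2)"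

definition regularized_Q :: "real \<Rightarrow> real \<Rightarrow> phase \<Rightarrow> real" where
  "regularized_Q \<mu> c = (\<lambda>((l, n), (pl, pn)).
     2 * pl\<^sup>2 - 2 * cosh l - c * (cosh l)\<^sup>2 +
     2 * pn\<^sup>2 + 2 * (1 - 2 * \<mu>) * cos n + c * (cos n)\<^sup>2)"

definition earth_component_cylinder ::
    "real \<Rightarrow> real \<Rightarrow> ((real \<times> complex) \<times> plane) set" where
  "earth_component_cylinder \<mu> c =
     (THE C. C \<in> components (wrap ` {x. regularized_Q \<mu> c x = 0}) \<and> (0, cis pi) \<in> fst ` C)"

definition regularized_earth_component :: "real \<Rightarrow> real \<Rightarrow> phase set" where
  "regularized_earth_component \<mu> c =
     {((l, n), P) | l n P. 0 < n \<and> n < 2 * pi \<and> wrap ((l, n), P) \<in> earth_component_cylinder \<mu> c}"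

lemma elliptic_q_has_derivative:
  "(elliptic_q has_derivative
     (\<lambda>(a, b). ((sinh l * cos n * a - cosh l * sin n * b) / 2,
                (cosh l * sin n * a + sinh l * cos n * b) / 2))) (at (l, n))"
proof -
  have f: "(fst has_derivative fst) (at (l, n))" and g: "(snd has_derivative snd) (at (l, n))"
    by (rule bounded_linear_imp_has_derivative, rule bounded_linear_fst bounded_linear_snd)+
  have ch: "((\<lambda>x. cosh (fst x)) has_derivative (\<lambda>v. fst v * sinh l)) (at (l, n))"
    and sh: "((\<lambda>x. sinh (fst x)) has_derivative (\<lambda>v. fst v * cosh l)) (at (l, n))"
    using DERIV_compose_FDERIV[of cosh "sinh l", OF _ f]
      DERIV_compose_FDERIV[of sinh "cosh l", OF _ f]
    by (simp_all add: has_field_derivative_cosh[OF DERIV_ident, simplified]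
      has_field_derivative_sinh[OF DERIV_ident, simplified])
  have co: "((\<lambda>x. cos (snd x)) has_derivative (\<lambda>v. snd v * - sin n)) (at (l, n))"
    and si: "((\<lambda>x. sin (snd x)) has_derivative (\<lambda>v. snd v * cos n)) (at (l, n))"
    using DERIV_compose_FDERIV[of cos "- sin n", OF _ g]
      DERIV_compose_FDERIV[of sin "cos n", OF _ g]
    by simp_all
  have "((\<lambda>x. (cosh (fst x) * cos (snd x) * (1/2), sinh (fst x) * sin (snd x) * (1/2)))
      has_derivative
        (\<lambda>v. ((cosh (fst (l, n)) * (snd v * - sin n) + fst v * sinh l * cos (snd (l, n))) * (1/2),
             (sinh (fst (l, n)) * (snd v * cos n) + fst v * cosh l * sin (snd (l, n))) * (1/2))))
      (at (l, n))"
    by (intro has_derivative_Pair has_derivative_mult_left has_derivative_mult ch sh co si)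
  then show ?thesis
    by (simp add: elliptic_q_def split_beta' add_divide_distrib diff_divide_distrib algebra_simps)
qed

lemma norm_elliptic_q:
  "norm (elliptic_q (l, n) - earth) = (cosh l + cos n) / 2"
  "norm (elliptic_q (l, n) - moon) = (cosh l - cos n) / 2"
proof -
  have c: "cosh l \<ge> 1" by (rule cosh_real_ge_1)
  have s: "(sinh l)\<^sup>2 = (cosh l)\<^sup>2 - 1" by (simp add: sinh_square_eq)
  have t: "(sin n)\<^sup>2 = 1 - (cos n)\<^sup>2" by (simp add: sin_squared_eq)
  have plus: "(cosh l * cos n / 2 + 1/2)\<^sup>2 + (sinh l * sin n / 2)\<^sup>2 = ((cosh l + cos n) / 2)\<^sup>2"
    unfolding power2_sum power2_diff power_divide power_mult_distrib s t by (simp add: field_simps)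
  have minus: "(cosh l * cos n / 2 - 1/2)\<^sup>2 + (sinh l * sin n / 2)\<^sup>2 = ((cosh l - cos n) / 2)\<^sup>2"
    unfolding power2_sum power2_diff power_divide power_mult_distrib s t by (simp add: field_simps)
  have "cosh l + cos n \<ge> 0" "cosh l - cos n \<ge> 0"
    using c cos_ge_minus_one[of n] cos_le_one[of n] by linarith+
  moreover have
    "norm (elliptic_q (l, n) - earth) =
       sqrt ((cosh l * cos n / 2 + 1/2)\<^sup>2 + (sinh l * sin n / 2)\<^sup>2)"
    "norm (elliptic_q (l, n) - moon) =
       sqrt ((cosh l * cos n / 2 - 1/2)\<^sup>2 + (sinh l * sin n / 2)\<^sup>2)"
    by (simp_all add: elliptic_q_def earth_def moon_def norm_Pair power_divide)
  ultimately show
    "norm (elliptic_q (l, n) - earth) = (cosh l + cos n) / 2"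
    "norm (elliptic_q (l, n) - moon) = (cosh l - cos n) / 2"
    unfolding plus minus by simp_all
qed

lemma regularized_Q_eq:
  assumes "((l, n), P) \<in> elliptic_domain"
  shows "regularized_Q \<mu> c ((l, n), P) =
    (euler_H \<mu> (elliptic_coords ((l, n), P)) - c) * ((cosh l)\<^sup>2 - (cos n)\<^sup>2)"
proof -
  obtain pl pn where P: "P = (pl, pn)" by (cases P)
  define A where "A = sinh l * cos n / 2"
  define B where "B = cosh l * sin n / 2"
  define K where "K = (cosh l)\<^sup>2 - (cos n)\<^sup>2"
  have ne: "cosh l + cos n \<noteq> 0" "cosh l - cos n \<noteq> 0"
    using assms norm_elliptic_q[of l n] by (auto simp: elliptic_domain_def)
  have K: "K = (cosh l + cos n) * (cosh l - cos n)"
    by (simp add: K_def power2_eq_square algebra_simps)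
  then have K0: "K \<noteq> 0" using ne by simp
  have s: "(sinh l)\<^sup>2 = (cosh l)\<^sup>2 - 1" by (simp add: sinh_square_eq)
  have t: "(sin n)\<^sup>2 = 1 - (cos n)\<^sup>2" by (simp add: sin_squared_eq)
  have AB: "A\<^sup>2 + B\<^sup>2 = K / 4"
    unfolding A_def B_def K_def power_divide power_mult_distrib s t
    by (simp add: field_simps)
  have D: "frechet_derivative elliptic_q (at (l, n)) = (\<lambda>(a, b). (A * a - B * b, B * a + A * b))"
    using frechet_derivative_at[OF elliptic_q_has_derivative[of l n]]
    by (auto simp: fun_eq_iff A_def B_def field_simps)
  define p where "p = (4 / K * (A * pl - B * pn), 4 / K * (B * pl + A * pn))"
  have iff: "(\<forall>v. P \<bullet> v = r \<bullet> frechet_derivative elliptic_q (at (l, n)) v) \<longleftrightarrow>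
      pl = A * fst r + B * snd r \<and> pn = A * snd r - B * fst r" (is "?L \<longleftrightarrow> ?R") for r
  proof
    assume L: ?L
    from L[rule_format, of "(1, 0)"] L[rule_format, of "(0, 1)"] show ?R
      by (cases r) (simp add: D P algebra_simps)
  next
    assume R: ?R
    show ?L unfolding D P R[THEN conjunct1] R[THEN conjunct2]
      by (cases r) (auto simp: algebra_simps)
  qed
  have sol: "(pl = A * fst r + B * snd r \<and> pn = A * snd r - B * fst r) \<longleftrightarrow> r = p" for r
  proof
    assume R: "pl = A * fst r + B * snd r \<and> pn = A * snd r - B * fst r"
    have "A * pl - B * pn = (A\<^sup>2 + B\<^sup>2) * fst r" "B * pl + A * pn = (A\<^sup>2 + B\<^sup>2) * snd r"
      unfolding R[THEN conjunct1] R[THEN conjunct2]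
      by (simp_all add: power2_eq_square algebra_simps)
    then show "r = p" using K0 by (cases r) (simp add: p_def AB field_simps)
  next
    assume r: "r = p"
    have "A * fst r + B * snd r = 4 / K * (A\<^sup>2 + B\<^sup>2) * pl"
      "A * snd r - B * fst r = 4 / K * (A\<^sup>2 + B\<^sup>2) * pn"
      unfolding r p_def by (simp_all add: power2_eq_square algebra_simps)
    then show "pl = A * fst r + B * snd r \<and> pn = A * snd r - B * fst r"
      using K0 by (simp add: AB)
  qed
  have coords: "elliptic_coords ((l, n), P) = (elliptic_q (l, n), p)"
    unfolding elliptic_coords_def prod.case iff sol by simp
  have "(norm p)\<^sup>2 = (4 / K)\<^sup>2 * ((A\<^sup>2 + B\<^sup>2) * (pl\<^sup>2 + pn\<^sup>2))"
    unfolding power2_norm_eq_inner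
    by (simp add: p_def power2_eq_square algebra_simps add_divide_distrib diff_divide_distrib)
  also have "\<dots> = 4 / K * (4 / K * (A\<^sup>2 + B\<^sup>2)) * (pl\<^sup>2 + pn\<^sup>2)"
    by (simp only: power2_eq_square[of "4 / K"] mult.assoc)
  also have "4 / K * (A\<^sup>2 + B\<^sup>2) = 1"
    using K0 by (simp add: AB)
  finally have "(norm p)\<^sup>2 = 4 / K * (pl\<^sup>2 + pn\<^sup>2)" by simp
  then have kin: "(norm p)\<^sup>2 / 2 * K = 2 * (pl\<^sup>2 + pn\<^sup>2)"
    using K0 by simp
  have pot: "(1 - \<mu>) / ((cosh l + cos n) / 2) * K = 2 * (1 - \<mu>) * (cosh l - cos n)"
    "\<mu> / ((cosh l - cos n) / 2) * K = 2 * \<mu> * (cosh l + cos n)"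
    unfolding K using ne by simp_all
  have "(euler_H \<mu> (elliptic_coords ((l, n), P)) - c) * K =
      (norm p)\<^sup>2 / 2 * K - (1 - \<mu>) / ((cosh l + cos n) / 2) * K
        - \<mu> / ((cosh l - cos n) / 2) * K - c * K"
    unfolding coords euler_H_def prod.case norm_elliptic_q by (simp only: left_diff_distrib)
  also have "\<dots> = regularized_Q \<mu> c ((l, n), P)"
    unfolding kin pot by (simp add: regularized_Q_def P K_def algebra_simps)
  finally show ?thesis by (simp add: K_def)
qed

end

(* In complex notation the coordinates are q = cosh(z)/2, so surjectivity and the two preimages +z and -z
   come from the inverse cosine, and the momenta transform by the cotangent lift.

   Put a = -c and k = 1 - 2 mu. Then Q = 2|p|^2 + f(l) + g(n) is separable, with
   f = a cosh^2 l - 2 cosh l and g = 2 k cos n - a cos^2 n. Below the critical energy f + g > 0 on the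
   lines a cos n = k, and on a cos n < k both summands grow away from (0, pi); hence {Q <= 0} is star-shaped
   there, its boundary is a sphere, and this boundary is the Earth component.

   On it the convexity condition reads g'^2 - 2 (f + g) g'' + (f'^2 / f'') g'' > 0. As
   f'^2 <= 2 (f - f(0)) f'', it suffices to consider l = 0. With y = -cos n the expression is
   a quartic in y whose derivative is 4 (a y^2 + 2 k y - a + 2)(4 a y + k), so its minimum is at the edge
   of the Hill region (where it is a positive square) or at y = -k/(4a). The latter value increases with a,
   is negative at the critical energy for k > 0, and its zero is the threshold energy. *)
theory Submission
  imports Defs
begin

text \<open>The cases split at \<open>\<mu> = 1/2\<close> because the well is
  \<open>y > - k / a\<close>: the critical point \<open>y = - k / (4 a)\<close> lies in it only for
  \<open>k > 0\<close>, and otherwise the minimum sits at the edge of the Hill region. The convexity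
  expression comes from minimising the Hessian form \<open>4 |P|^2 + f'' v_l^2 + g'' v_n^2\<close>
  over tangent vectors with given \<open>v_n\<close>. Tangency reads
  \<open>- g' v_n = 4 p . P + f' v_l\<close>. By Cauchy-Schwarz the square of the right side is at
  most \<open>4 |p|^2 + f'^2 / f''\<close> times the part of the form without \<open>v_n\<close>,
  and \<open>4 |p|^2 = - 2 (f + g)\<close> on the surface. Failure of convexity has to be shown for
  every differentiable unit normal field, and also at the threshold, where the form only
  degenerates. It is therefore read off from accelerations of curves in the surface.\<close>

section \<open>Hypersurfaces: star-shaped bodies, level sets and curves\<close>

text \<open>An interior point of \<open>K\<close>, pushed slightly away from \<open>a\<close>, stays
  in \<open>K\<close>, so the point lies on an open segment from \<open>a\<close> and hence in
  \<open>D\<close>; thus \<open>interior K = D\<close>. Each point of \<open>K\<close> is the limit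
  of its own segment, so \<open>closure D = K\<close>. Radial projection turns \<open>K - D\<close>
  into a sphere, connected from dimension two on.\<close>

lemma
  fixes K D :: "'a::euclidean_space set"
  assumes dim: "2 \<le> DIM('a)" and K: "compact K" and D: "open D" "D \<subseteq> K" "a \<in> D"
    and star: "\<And>x. x \<in> K \<Longrightarrow> open_segment a x \<subseteq> D"
  shows frontier_starlike_body: "frontier D = K - D"
    and connected_frontier_starlike_body: "connected (K - D)"
    and connected_interior_starlike_body: "connected D"
proof -
  have int: "interior K = D"
  proof
    show "D \<subseteq> interior K" using D by (simp add: interior_maximal)
    show "interior K \<subseteq> D"
    proof
      fix x assume "x \<in> interior K"
      then obtain e where e: "e > 0" "cball x e \<subseteq> K" by (auto simp: mem_interior_cball)
      show "x \<in> D"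
      proof (cases "x = a")
        case False
        define y where "y = x + (e / norm (x - a)) *\<^sub>R (x - a)"
        have n: "norm (x - a) > 0" using False by simp
        have "dist x y = e" using n e by (simp add: y_def dist_norm)
        then have "y \<in> K" using e by auto
        define t where "t = norm (x - a) / (norm (x - a) + e)"
        have "0 < norm (x - a) + e" using n e by linarith
        then have t: "0 < t" "t < 1" unfolding t_def using n e(1)
          by (simp_all only: divide_pos_pos divide_less_eq_1_pos)
        have "1 + e / norm (x - a) = (norm (x - a) + e) / norm (x - a)" using n
          by (simp add: add_divide_distrib)
        then have "t * (1 + e / norm (x - a)) = 1"
          unfolding t_def using n \<open>0 < norm (x - a) + e\<close> by simp
        then have "t *\<^sub>R (y - a) = x - a"
        proof -
          have "y - a = (1 + e / norm (x - a)) *\<^sub>R (x - a)" by (simp add: y_def algebra_simps)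
          then show ?thesis using \<open>t * (1 + e / norm (x - a)) = 1\<close> by simp
        qed
        then have "x = (1 - t) *\<^sub>R a + t *\<^sub>R y" by (simp add: algebra_simps)
        moreover have "a \<noteq> y" using \<open>t *\<^sub>R (y - a) = x - a\<close> False by auto
        ultimately have "x \<in> open_segment a y" using t by (auto simp: in_segment)
        then show ?thesis using star[OF \<open>y \<in> K\<close>] by blast
      qed (use D in simp)
    qed
  qed
  have "K \<subseteq> closure D"
  proof
    fix x assume "x \<in> K"
    show "x \<in> closure D"
    proof (cases "x = a")
      case False
      have "closure (open_segment a x) \<subseteq> closure D" by (rule closure_mono[OF star[OF \<open>x \<in> K\<close>]])
      then show ?thesis using False by (simp add: subset_iff)
    qed (use D closure_subset in auto)
  qed
  moreover have "closure D \<subseteq> K" using D K by (simp add: closure_minimal compact_imp_closed)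
  ultimately show "frontier D = K - D" using D
    by (simp add: frontier_def interior_open subset_antisym)
  have ne: "interior K \<noteq> {}" using int D by auto
  have rel: "rel_interior K = D" using rel_interior_nonempty_interior[OF ne] int by simp
  have "K - D homeomorphic sphere a 1 \<inter> affine hull K"
    using starlike_compact_projective1[OF K, of a] D star rel by simp
  then show "connected (K - D)"
    using connected_sphere[OF dim]
      by (simp add: affine_hull_nonempty_interior[OF ne] homeomorphic_connectedness)
  have "starlike D"
  proof -
    have "closed_segment a x \<subseteq> D" if "x \<in> D" for x
      using star[of x] that D closed_segment_eq_open by blast
    then show ?thesis unfolding starlike_def using D by blast
  qed
  then show "connected D" by (rule starlike_imp_connected)
qed

lemma gradient_orthogonal_tangent_space:
  assumes "GDERIV \<rho> x :> g" and "\<And>y. y \<in> S \<Longrightarrow> \<rho> y = 0" and "v \<in> tangent_space S x"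
  shows "g \<bullet> v = 0"
proof -
  obtain \<gamma> where \<gamma>: "\<gamma> 0 = x" "\<forall>\<^sub>F t in nhds 0. \<gamma> t \<in> S" "(\<gamma> has_vector_derivative v) (at 0)"
    using assms(3) by (auto simp: tangent_space_def)
  have "((\<rho> \<circ> \<gamma>) has_derivative (\<lambda>t. (t *\<^sub>R v) \<bullet> g)) (at 0)"
    using diff_chain_at[OF \<gamma>(3)[unfolded has_vector_derivative_def], of \<rho> "\<lambda>h. h \<bullet> g"] assms(1) \<gamma>(1)
    by (simp add: gderiv_def o_def)
  moreover have "((\<rho> \<circ> \<gamma>) has_derivative (\<lambda>t. 0)) (at 0)"
  proof (rule has_derivative_transform_eventually)
    show "((\<lambda>t. 0) has_derivative (\<lambda>t. 0)) (at 0)" by simp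
    show "\<forall>\<^sub>F t in at 0. 0 = (\<rho> \<circ> \<gamma>) t"
      using eventually_nhds_x_imp_x[OF \<gamma>(2)] \<gamma>(2) assms(2)
      by (auto simp: eventually_at_filter elim: eventually_mono)
    show "0 = (\<rho> \<circ> \<gamma>) 0" using eventually_nhds_x_imp_x[OF \<gamma>(2)] assms(2) by simp
  qed simp
  ultimately have "(\<lambda>t. (t *\<^sub>R v) \<bullet> g) = (\<lambda>t. 0)" by (rule has_derivative_unique)
  from fun_cong[OF this, of 1] show ?thesis by (simp add: inner_commute)
qed

text \<open>For \<open>N = - g / |g|\<close> the derivative is \<open>- h / |g|\<close> plus a
  multiple of \<open>g\<close>, and the multiple is orthogonal to every tangent vector. Asking for
  positivity on the whole complement of \<open>g x\<close> means that only the inclusion of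
  \<open>tangent_space\<close> in this complement enters.\<close>

lemma strictly_convex_hypersurface_if_hessian_positive:
  fixes S :: "'a::euclidean_space set"
  assumes S: "closed_hypersurface S" and D: "open D" "connected D" "bounded D" "frontier D = S"
    and \<rho>: "\<And>x. x \<in> S \<Longrightarrow> \<rho> x = 0" "\<And>x. x \<in> S \<Longrightarrow> GDERIV \<rho> x :> g x"
    and g: "\<And>x. x \<in> S \<Longrightarrow> g x \<noteq> 0" "\<And>x. x \<in> S \<Longrightarrow> (g has_derivative h x) (at x)"
    and pos: "\<And>x v. x \<in> S \<Longrightarrow> v \<noteq> 0 \<Longrightarrow> g x \<bullet> v = 0 \<Longrightarrow> h x v \<bullet> v > 0"
  shows "strictly_convex_hypersurface S"
proof -
  define N where "N = (\<lambda>x. - (inverse (norm (g x)) *\<^sub>R g x))"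
  have orth: "g x \<bullet> v = 0" if "x \<in> S" "v \<in> tangent_space S x" for x v
    using gradient_orthogonal_tangent_space[OF \<rho>(2)[OF that(1)] \<rho>(1) that(2)] .
  have der: "\<exists>s. (N has_derivative (\<lambda>v. - (inverse (norm (g x)) *\<^sub>R h x v + s v *\<^sub>R g x))) (at x)"
    if "x \<in> S" for x
  proof -
    have "(\<lambda>x. norm (g x)) differentiable (at x)"
      using differentiable_chain_at[of g x norm] g[OF that] differentiable_norm_at
      by (auto simp: o_def differentiable_def)
    then have "(\<lambda>x. inverse (norm (g x))) differentiable (at x)"
      using g(1)[OF that] by (intro differentiable_inverse) auto
    then obtain s where "((\<lambda>x. inverse (norm (g x))) has_derivative s) (at x)"
      by (auto simp: differentiable_def)
    from has_derivative_minus[OF has_derivative_scaleR[OF this g(2)[OF that]]] show ?thesis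
      unfolding N_def by blast
  qed
  have "unit_normal_field S N"
    unfolding unit_normal_field_def
  proof (intro ballI conjI)
    fix x assume x: "x \<in> S"
    show "N differentiable (at x)" using der[OF x] by (auto simp: differentiable_def)
    show "norm (N x) = 1" using g(1)[OF x] by (simp add: N_def)
    fix v assume "v \<in> tangent_space S x"
    then show "N x \<bullet> v = 0" using orth[OF x] by (simp add: N_def)
  qed
  moreover have "second_fundamental_form N x v v > 0"
    if x: "x \<in> S" and v: "v \<in> tangent_space S x" "v \<noteq> 0" for x v
  proof -
    obtain s where s: "(N has_derivative (\<lambda>v. - (inverse (norm (g x)) *\<^sub>R h x v + s v *\<^sub>R g x)))
        (at x)"
      using der[OF x] by blast
    have "second_fundamental_form N x v v = inverse (norm (g x)) * (h x v \<bullet> v)"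
      unfolding second_fundamental_form_def frechet_derivative_at[OF s, symmetric]
      using orth[OF x v(1)] by (simp add: inner_add_left inner_diff_left)
    then show ?thesis using pos[OF x v(2) orth[OF x v(1)]] g(1)[OF x] by simp
  qed
  ultimately show ?thesis
    unfolding strictly_convex_hypersurface_def using S D by blast
qed

lemma has_vector_derivative_in_tangent_space:
  assumes "open I" "t \<in> I" "\<And>s. s \<in> I \<Longrightarrow> \<gamma> s \<in> S" "(\<gamma> has_vector_derivative v) (at t)"
  shows "v \<in> tangent_space S (\<gamma> t)"
proof -
  define \<delta> where "\<delta> = (\<lambda>s. \<gamma> (t + s))"
  have "((\<lambda>s. t + s) has_vector_derivative 1) (at 0)"
    by (auto intro!: derivative_eq_intros)
  then have "(\<delta> has_vector_derivative v) (at 0)"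
    using vector_diff_chain_at[of "\<lambda>s. t + s" 1 0 \<gamma> v] assms(4) by (simp add: \<delta>_def o_def)
  moreover have "\<forall>\<^sub>F s in nhds 0. \<delta> s \<in> S"
  proof -
    have "((\<lambda>s. t + s) \<longlongrightarrow> t) (nhds 0)"
      by (auto intro!: tendsto_eq_intros filterlim_ident)
    then have "\<forall>\<^sub>F s in nhds 0. t + s \<in> I" using assms(1,2) topological_tendstoD by blast
    then show ?thesis using assms(3) by (auto simp: \<delta>_def elim: eventually_mono)
  qed
  ultimately show ?thesis unfolding tangent_space_def by (auto simp: \<delta>_def intro!: exI[of _ \<delta>])
qed

text \<open>Differentiating \<open>N(\<gamma>) \<bullet> \<gamma>' = 0\<close> along the curve; this avoids identifying \<open>N\<close> with the
  normalised gradient and hence any discussion of its sign.\<close>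

lemma second_fundamental_form_curve:
  assumes N: "unit_normal_field S N" and I: "open I" "t \<in> I"
    and \<gamma>: "\<And>s. s \<in> I \<Longrightarrow> \<gamma> s \<in> S" "\<And>s. s \<in> I \<Longrightarrow> (\<gamma> has_vector_derivative \<gamma>' s) (at s)"
    and \<gamma>': "(\<gamma>' has_vector_derivative w) (at t)"
  shows "second_fundamental_form N (\<gamma> t) (\<gamma>' t) (\<gamma>' t) = N (\<gamma> t) \<bullet> w"
proof -
  have tan: "\<gamma>' s \<in> tangent_space S (\<gamma> s)" if "s \<in> I" for s
    using has_vector_derivative_in_tangent_space[OF I(1) that \<gamma>(1) \<gamma>(2)[OF that]] by blast
  have z: "N (\<gamma> s) \<bullet> \<gamma>' s = 0" if "s \<in> I" for s
    using N tan[OF that] \<gamma>(1)[OF that] by (auto simp: unit_normal_field_def)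
  define N' where "N' = frechet_derivative N (at (\<gamma> t))"
  have N': "(N has_derivative N') (at (\<gamma> t))"
    using N \<gamma>(1)[OF I(2)] by (simp add: N'_def unit_normal_field_def frechet_derivative_works)
  have 1: "((\<lambda>s. N (\<gamma> s)) has_derivative (\<lambda>s. N' (s *\<^sub>R \<gamma>' t))) (at t)"
    using diff_chain_at[OF \<gamma>(2)[OF I(2), unfolded has_vector_derivative_def] N']
      by (simp add: o_def)
  have "((\<lambda>s. N (\<gamma> s) \<bullet> \<gamma>' s) has_derivative
      (\<lambda>s. N (\<gamma> t) \<bullet> (s *\<^sub>R w) + N' (s *\<^sub>R \<gamma>' t) \<bullet> \<gamma>' t)) (at t)"
    by (rule has_derivative_inner[OF 1 \<gamma>'[unfolded has_vector_derivative_def]])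
  moreover have "((\<lambda>s. N (\<gamma> s) \<bullet> \<gamma>' s) has_derivative (\<lambda>s. 0)) (at t)"
    by (rule has_derivative_transform_within_open[OF _ I]) (use z in auto)
  ultimately have "(\<lambda>s. N (\<gamma> t) \<bullet> (s *\<^sub>R w) + N' (s *\<^sub>R \<gamma>' t) \<bullet> \<gamma>' t) = (\<lambda>s. 0)"
    by (rule has_derivative_unique)
  from fun_cong[OF this, of 1] show ?thesis
    by (simp add: second_fundamental_form_def N'_def)
qed

section \<open>Elliptic coordinates\<close>

text \<open>With \<open>z = l + i n\<close> the map \<^const>\<open>elliptic_q\<close> is \<open>cosh z / 2\<close>; its complex derivative
  \<open>sinh z / 2\<close> is \<open>ell_A + i ell_B\<close>.\<close>

definition ell_A :: "real \<Rightarrow> real \<Rightarrow> real" where "ell_A l n = sinh l * cos n / 2"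
definition ell_B :: "real \<Rightarrow> real \<Rightarrow> real" where "ell_B l n = cosh l * sin n / 2"

lemma frechet_elliptic_q:
  "frechet_derivative elliptic_q (at (l, n)) =
     (\<lambda>(a, b). (ell_A l n * a - ell_B l n * b, ell_B l n * a + ell_A l n * b))"
  using frechet_derivative_at[OF elliptic_q_has_derivative[of l n]]
  by (auto simp: fun_eq_iff ell_A_def ell_B_def field_simps)

text \<open>By \<open>norm_elliptic_q\<close>, the Jacobian determinant
  \<open>ell_A^2 + ell_B^2\<close> is the product of the distances to Earth and Moon, so it vanishes
  exactly at collisions.\<close>

lemma ell_AB: "4 * ((ell_A l n)\<^sup>2 + (ell_B l n)\<^sup>2) = (cosh l + cos n) * (cosh l - cos n)"
proof -
  have s: "(sinh l)\<^sup>2 = (cosh l)\<^sup>2 - 1" by (simp add: sinh_square_eq)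
  have t: "(sin n)\<^sup>2 = 1 - (cos n)\<^sup>2" by (simp add: sin_squared_eq)
  show ?thesis unfolding ell_A_def ell_B_def power_divide power_mult_distrib s t
    by (simp add: field_simps power2_eq_square)
qed

lemma elliptic_domain_iff:
  "((l, n), P) \<in> elliptic_domain \<longleftrightarrow> (ell_A l n)\<^sup>2 + (ell_B l n)\<^sup>2 \<noteq> 0"
proof -
  have "elliptic_q (l, n) = earth \<longleftrightarrow> cosh l + cos n = 0"
       "elliptic_q (l, n) = moon \<longleftrightarrow> cosh l - cos n = 0"
    using norm_elliptic_q[of l n]
      by (metis div_0 eq_iff_diff_eq_0 norm_eq_zero divide_eq_0_iff zero_neq_numeral)+
  then have "((l, n), P) \<in> elliptic_domain \<longleftrightarrow> (cosh l + cos n) * (cosh l - cos n) \<noteq> 0"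
    by (simp add: elliptic_domain_def)
  then show ?thesis unfolding ell_AB[symmetric] mult_eq_0_iff by simp
qed

text \<open>With \<open>w = ell_A + i ell_B\<close>, the transpose of multiplication by
  \<open>w\<close> is multiplication by its conjugate. The formula is thus
  \<open>p = P / cnj w = w P / |w|^2\<close> in complex notation.\<close>

lemma elliptic_coords_eq:
  fixes l n pl pn
  defines "R \<equiv> (ell_A l n)\<^sup>2 + (ell_B l n)\<^sup>2"
  assumes "((l, n), (pl, pn)) \<in> elliptic_domain"
  shows "elliptic_coords ((l, n), (pl, pn)) = (elliptic_q (l, n),
    ((ell_A l n * pl - ell_B l n * pn) / R, (ell_B l n * pl + ell_A l n * pn) / R))"
proof -
  have R0: "R \<noteq> 0" using assms elliptic_domain_iff by simp
  define A B where "A = ell_A l n" and "B = ell_B l n"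
  have R: "R = A * A + B * B" by (simp add: R_def A_def B_def power2_eq_square)
  have iff: "(\<forall>v. (pl, pn) \<bullet> v = r \<bullet> frechet_derivative elliptic_q (at (l, n)) v) \<longleftrightarrow>
      pl = A * fst r + B * snd r \<and> pn = A * snd r - B * fst r" (is "?L \<longleftrightarrow> ?R") for r
  proof
    assume L: ?L
    from L[rule_format, of "(1, 0)"] L[rule_format, of "(0, 1)"] show ?R
      by (cases r) (simp add: frechet_elliptic_q A_def B_def algebra_simps)
  next
    assume R: ?R
    show ?L unfolding frechet_elliptic_q R[THEN conjunct1] R[THEN conjunct2]
      by (cases r) (auto simp: algebra_simps A_def B_def)
  qed
  have "(THE p. \<forall>v. (pl, pn) \<bullet> v = p \<bullet> frechet_derivative elliptic_q (at (l, n)) v)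
     = ((A * pl - B * pn) / R, (B * pl + A * pn) / R)"
    unfolding iff
  proof (rule the_equality)
    have "A * ((A * pl - B * pn) / R) + B * ((B * pl + A * pn) / R) = (R * pl) / R"
         "A * ((B * pl + A * pn) / R) - B * ((A * pl - B * pn) / R) = (R * pn) / R"
      unfolding R by (simp_all add: algebra_simps flip: add_divide_distrib diff_divide_distrib)
    then show "pl = A * fst ((A * pl - B * pn) / R, (B * pl + A * pn) / R) +
           B * snd ((A * pl - B * pn) / R, (B * pl + A * pn) / R) \<and>
      pn = A * snd ((A * pl - B * pn) / R, (B * pl + A * pn) / R) -
           B * fst ((A * pl - B * pn) / R, (B * pl + A * pn) / R)"
      using R0 by simp
  next
    fix r assume r: "pl = A * fst r + B * snd r \<and> pn = A * snd r - B * fst r"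
    have "A * pl - B * pn = R * fst r" "B * pl + A * pn = R * snd r"
      unfolding r[THEN conjunct1] r[THEN conjunct2] R by (simp_all add: algebra_simps)
    then show "r = ((A * pl - B * pn) / R, (B * pl + A * pn) / R)"
      using R0 by (simp add: prod_eq_iff)
  qed
  then show ?thesis by (simp add: elliptic_coords_def A_def B_def)
qed

lemma elliptic_coords_eq_iff:
  assumes "((l, n), (pl, pn)) \<in> elliptic_domain"
  shows "elliptic_coords ((l, n), (pl, pn)) = (q, (p1, p2)) \<longleftrightarrow> elliptic_q (l, n) = q \<and>
     pl = ell_A l n * p1 + ell_B l n * p2 \<and> pn = ell_A l n * p2 - ell_B l n * p1"
proof -
  define A B where "A = ell_A l n" and "B = ell_B l n"
  have R0: "A * A + B * B \<noteq> 0" using assms elliptic_domain_iff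
    by (simp add: A_def B_def power2_eq_square)
  have "(A * pl - B * pn = p1 * (A * A + B * B) \<and> B * pl + A * pn = p2 * (A * A + B * B)) \<longleftrightarrow>
     pl = A * p1 + B * p2 \<and> pn = A * p2 - B * p1" (is "?L \<longleftrightarrow> ?R")
  proof
    assume L: ?L
    have "(A * A + B * B) * pl = A * (A * pl - B * pn) + B * (B * pl + A * pn)"
         "(A * A + B * B) * pn = A * (B * pl + A * pn) - B * (A * pl - B * pn)"
      by (simp_all add: algebra_simps)
    then have "(A * A + B * B) * pl = (A * A + B * B) * (A * p1 + B * p2)"
         "(A * A + B * B) * pn = (A * A + B * B) * (A * p2 - B * p1)"
      unfolding L[THEN conjunct1] L[THEN conjunct2] by (simp_all add: algebra_simps)
    then show ?R using R0 by auto
  next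
    assume R: ?R
    show ?L unfolding R[THEN conjunct1] R[THEN conjunct2] by (simp add: algebra_simps)
  qed
  then show ?thesis
    unfolding elliptic_coords_eq[OF assms] using R0
    by (simp add: A_def B_def power2_eq_square field_simps)
qed

text \<open>\<open>Complex n (- l)\<close> is \<open>- i z\<close>, and
  \<open>cosh z = cos (- i z)\<close>. Fibres and surjectivity then follow from
  \<open>complex_cos_eq\<close> and \<open>Arccos\<close>.\<close>

lemma elliptic_q_cos:
  "elliptic_q (l, n) = (Re (cos (Complex n (- l))) / 2, Im (cos (Complex n (- l))) / 2)"
  by (simp add: elliptic_q_def Re_cos Im_cos cosh_field_def sinh_field_def field_simps)

lemma elliptic_q_eq_iff:
  "elliptic_q (l, n) = elliptic_q (l', n') \<longleftrightarrow>
     l = l' \<and> cis n = cis n' \<or> l = - l' \<and> cis n = cis (- n')"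
proof -
  have cis: "cis x = cis y \<longleftrightarrow> (\<exists>m\<in>\<int>. x = y + 2 * m * pi)" for x y
    using sin_cos_eq_iff[of x y] by (auto simp: complex_eq_iff Ints_def algebra_simps)
  have "elliptic_q (l, n) = elliptic_q (l', n') \<longleftrightarrow> cos (Complex n (- l)) = cos (Complex n' (- l'))"
    by (auto simp: elliptic_q_cos complex_eq_iff)
  also have "\<dots> \<longleftrightarrow> l = l' \<and> cis n = cis n' \<or> l = - l' \<and> cis n = cis (- n')"
    unfolding complex_cos_eq cis by (auto simp: complex_eq_iff)
  finally show ?thesis .
qed

lemma elliptic_q_surj: "\<exists>l n. elliptic_q (l, n) = q"
proof -
  define z where "z = Arccos (Complex (2 * fst q) (2 * snd q))"
  have "cos z = Complex (2 * fst q) (2 * snd q)" by (simp add: z_def)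
  then have "elliptic_q (- Im z, Re z) = q"
    unfolding elliptic_q_cos by (simp add: prod_eq_iff)
  then show ?thesis by blast
qed

lemma elliptic_two_to_one: "two_to_one_mod_2pi elliptic_domain noncollision elliptic_coords"
proof -
  have AB: "ell_A (- l) (- n) = - ell_A l n" "ell_B (- l) (- n) = - ell_B l n" for l n
    by (simp_all add: ell_A_def ell_B_def)
  have wrapeq: "wrap ((l, n), P) = wrap ((l', n'), P') \<longleftrightarrow> l = l' \<and> cis n = cis n' \<and> P = P'"
    for l n P l' n' P'
    by (auto simp: wrap_def)
  have AB': "ell_A l n = ell_A l n'" "ell_B l n = ell_B l n'" if "cis n = cis n'" for l n n'
    using that by (simp_all add: ell_A_def ell_B_def complex_eq_iff)
  have 1: "elliptic_coords x = elliptic_coords y"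
    if "x \<in> elliptic_domain" "y \<in> elliptic_domain" "wrap x = wrap y" for x y
  proof -
    obtain l n pl pn l' n' pl' pn' where x: "x = ((l, n), (pl, pn))"
      and y: "y = ((l', n'), (pl', pn'))"
      by (metis surj_pair)
    have e: "l = l'" "cis n = cis n'" "pl = pl'" "pn = pn'" using that(3) unfolding x y wrapeq
      by auto
    have "elliptic_q (l, n) = elliptic_q (l', n')" using e by (simp add: elliptic_q_eq_iff)
    then show ?thesis using that e AB'[of n n' l'] by (simp add: x y elliptic_coords_eq)
  qed
  have dom: "((l, n), P) \<in> elliptic_domain \<longleftrightarrow> elliptic_q (l, n) \<noteq> earth \<and> elliptic_q (l, n) \<noteq> moon"
    for l n P
    by (simp add: elliptic_domain_def)
  have 2: "elliptic_coords ` elliptic_domain \<subseteq> noncollision"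
    by (auto simp: elliptic_domain_def noncollision_def elliptic_coords_def)
  have 3: "card (wrap ` {x \<in> elliptic_domain. elliptic_coords x = y}) = 2" if "y \<in> noncollision"
    for y
  proof -
    obtain q p1 p2 where y: "y = (q, (p1, p2))" by (metis surj_pair)
    obtain l n where q: "elliptic_q (l, n) = q" using elliptic_q_surj by blast
    have ne: "q \<noteq> earth" "q \<noteq> moon" using that by (auto simp: y noncollision_def)
    have q': "elliptic_q (- l, - n) = q" using q elliptic_q_eq_iff[of l n "- l" "- n"] by simp
    define pl where "pl = ell_A l n * p1 + ell_B l n * p2"
    define pn where "pn = ell_A l n * p2 - ell_B l n * p1"
    define a where "a = ((l, n), (pl, pn))"
    \<comment> \<open>The momenta change sign together with \<open>z\<close> because the derivative
      \<open>sinh z / 2\<close> is odd.\<close>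
    define b where "b = ((- l, - n), (- pl, - pn))"
    have ab: "a \<in> elliptic_domain" "b \<in> elliptic_domain" using ne q q'
      by (simp_all add: a_def b_def dom)
    have "elliptic_coords a = y" "elliptic_coords b = y"
      unfolding y a_def b_def using ab q q'
      by (simp_all add: elliptic_coords_eq_iff a_def b_def pl_def pn_def AB)
    moreover have "wrap x = wrap a \<or> wrap x = wrap b"
      if x: "x \<in> elliptic_domain" "elliptic_coords x = y" for x
    proof -
      obtain l' n' pl' pn' where xe: "x = ((l', n'), (pl', pn'))" by (metis surj_pair)
      have h: "elliptic_q (l', n') = q" "pl' = ell_A l' n' * p1 + ell_B l' n' * p2"
        "pn' = ell_A l' n' * p2 - ell_B l' n' * p1"
        using x elliptic_coords_eq_iff unfolding xe y by blast+
      from h(1) q elliptic_q_eq_iff[of l' n' l n]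
      consider "l' = l" "cis n' = cis n" | "l' = - l" "cis n' = cis (- n)" by auto
      then show ?thesis
      proof cases
        case 1
        then show ?thesis using h(2,3) AB'[of n' n l]
          by (simp add: xe a_def b_def wrapeq pl_def pn_def)
      next
        case 2
        then show ?thesis using h(2,3) AB'[of n' "- n" "- l"] AB[of l n]
          by (simp add: xe a_def b_def wrapeq pl_def pn_def)
      qed
    qed
    ultimately have "wrap ` {x \<in> elliptic_domain. elliptic_coords x = y} = {wrap a, wrap b}"
      using ab by blast
    \<comment> \<open>The two preimages coincide only where \<open>sinh z = 0\<close>, which is a
      collision.\<close>
    moreover have "wrap a \<noteq> wrap b"
    proof
      assume "wrap a = wrap b"
      then have "l = 0" "sin n = 0" by (auto simp: a_def b_def wrapeq complex_eq_iff)
      then have "ell_A l n = 0" "ell_B l n = 0" by (simp_all add: ell_A_def ell_B_def)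
      then show False using ab(1) unfolding a_def elliptic_domain_iff by simp
    qed
    ultimately show ?thesis by simp
  qed
  show ?thesis unfolding two_to_one_mod_2pi_def using 1 2 3 by blast
qed

section \<open>Derivative and symplecticity of the elliptic coordinates\<close>

lemma has_derivative_cosh_real:
  fixes f :: "'a::real_normed_vector \<Rightarrow> real"
  assumes "(f has_derivative f') (at x)"
  shows "((\<lambda>x. cosh (f x)) has_derivative (\<lambda>h. f' h * sinh (f x))) (at x)"
  using DERIV_compose_FDERIV[OF has_field_derivative_cosh[OF DERIV_ident] assms] by simp

lemma has_derivative_sinh_real:
  fixes f :: "'a::real_normed_vector \<Rightarrow> real"
  assumes "(f has_derivative f') (at x)"
  shows "((\<lambda>x. sinh (f x)) has_derivative (\<lambda>h. f' h * cosh (f x))) (at x)"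
  using DERIV_compose_FDERIV[OF has_field_derivative_sinh[OF DERIV_ident] assms] by simp

lemma has_derivative_cosh_cos:
  fixes f :: "'a::real_normed_vector \<Rightarrow> real"
  assumes "(f has_derivative f') (at x)" "(g has_derivative g') (at x)"
  shows "((\<lambda>x. cosh (f x) * cos (g x) / 2) has_derivative
    (\<lambda>h. ell_A (f x) (g x) * f' h - ell_B (f x) (g x) * g' h)) (at x)"
  using has_derivative_mult_left[OF has_derivative_mult[OF has_derivative_cosh_real[OF assms(1)]
      has_derivative_cos[OF assms(2)]], of "1/2"]
  by (simp add: ell_A_def ell_B_def algebra_simps)

lemma has_derivative_sinh_sin:
  fixes f :: "'a::real_normed_vector \<Rightarrow> real"
  assumes "(f has_derivative f') (at x)" "(g has_derivative g') (at x)"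
  shows "((\<lambda>x. sinh (f x) * sin (g x) / 2) has_derivative
    (\<lambda>h. ell_B (f x) (g x) * f' h + ell_A (f x) (g x) * g' h)) (at x)"
  using has_derivative_mult_left[OF has_derivative_mult[OF has_derivative_sinh_real[OF assms(1)]
      has_derivative_sin[OF assms(2)]], of "1/2"]
  by (simp add: ell_A_def ell_B_def algebra_simps)

lemma has_derivative_ell_A:
  fixes f :: "'a::real_normed_vector \<Rightarrow> real"
  assumes "(f has_derivative f') (at x)" "(g has_derivative g') (at x)"
  shows "((\<lambda>x. ell_A (f x) (g x)) has_derivative
    (\<lambda>h. cosh (f x) * cos (g x) / 2 * f' h - sinh (f x) * sin (g x) / 2 * g' h)) (at x)"
  using has_derivative_mult_left[OF has_derivative_mult[OF has_derivative_sinh_real[OF assms(1)]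
      has_derivative_cos[OF assms(2)]], of "1/2"]
  by (simp add: ell_A_def algebra_simps)

lemma has_derivative_ell_B:
  fixes f :: "'a::real_normed_vector \<Rightarrow> real"
  assumes "(f has_derivative f') (at x)" "(g has_derivative g') (at x)"
  shows "((\<lambda>x. ell_B (f x) (g x)) has_derivative
    (\<lambda>h. sinh (f x) * sin (g x) / 2 * f' h + cosh (f x) * cos (g x) / 2 * g' h)) (at x)"
  using has_derivative_mult_left[OF has_derivative_mult[OF has_derivative_cosh_real[OF assms(1)]
      has_derivative_sin[OF assms(2)]], of "1/2"]
  by (simp add: ell_B_def algebra_simps)

text \<open>This is the quotient rule for \<open>(U + i V) / (A - i B)\<close>, whose value at
  \<open>x\<close> is \<open>p + i r\<close>: the derivative is \<open>c + i d\<close> divided by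
  \<open>A - i B\<close>, with \<open>c + i d = (U + i V)' - (p + i r) (A - i B)'\<close>.\<close>

lemma has_derivative_complex_quotient:
  fixes A B U V :: "'a::real_normed_vector \<Rightarrow> real"
  assumes "(A has_derivative A') (at x)" "(B has_derivative B') (at x)"
    "(U has_derivative U') (at x)" "(V has_derivative V') (at x)"
    and R0: "(A x)\<^sup>2 + (B x)\<^sup>2 \<noteq> 0"
  defines "R \<equiv> (A x)\<^sup>2 + (B x)\<^sup>2"
  defines "p \<equiv> (A x * U x - B x * V x) / R" and "r \<equiv> (B x * U x + A x * V x) / R"
  defines "c \<equiv> \<lambda>h. U' h - p * A' h - r * B' h" and "d \<equiv> \<lambda>h. V' h - r * A' h + p * B' h"
  shows "((\<lambda>x. (A x * U x - B x * V x) / ((A x)\<^sup>2 + (B x)\<^sup>2)) has_derivative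
      (\<lambda>h. (A x * c h - B x * d h) / R)) (at x)" (is ?t1)
    and "((\<lambda>x. (B x * U x + A x * V x) / ((A x)\<^sup>2 + (B x)\<^sup>2)) has_derivative
      (\<lambda>h. (B x * c h + A x * d h) / R)) (at x)" (is ?t2)
proof -
  have R: "R \<noteq> 0" "(A x)\<^sup>2 + (B x)\<^sup>2 = R" using R0 by (simp_all add: R_def)
  have RAB: "R = A x * A x + B x * B x" by (simp add: R_def power2_eq_square)
  have Rpr: "R * p = A x * U x - B x * V x" "R * r = B x * U x + A x * V x"
    using R(1) by (simp_all add: p_def r_def)
  have "R * (A x * p + B x * r) = A x * (R * p) + B x * (R * r)"
    "R * (A x * r - B x * p) = A x * (R * r) - B x * (R * p)" by (simp_all add: algebra_simps)
  moreover have "A x * (R * p) + B x * (R * r) = R * U x" "A x * (R * r) - B x * (R * p) = R * V x"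
    unfolding Rpr by (simp_all add: RAB algebra_simps)
  ultimately have "R * (A x * p + B x * r) = R * U x" "R * (A x * r - B x * p) = R * V x"
    by (simp_all only:)
  then have UV: "U x = A x * p + B x * r" "V x = A x * r - B x * p" using R(1) by auto
  have "((\<lambda>x. (A x * U x - B x * V x) / ((A x)\<^sup>2 + (B x)\<^sup>2)) has_derivative
      (\<lambda>h. (A' h * U x + A x * U' h - B' h * V x - B x * V' h - p * (2 * A x * A' h + 2 * B x * B'
          h)) / R)) (at x)"
    using R by (auto intro!: derivative_eq_intros assms simp: p_def fun_eq_iff field_simps
        power2_eq_square)
  moreover have "A' h * U x + A x * U' h - B' h * V x - B x * V' h - p * (2 * A x * A' h + 2 * B x
      * B' h)
     = A x * c h - B x * d h" for h
    unfolding UV c_def d_def by (simp add: algebra_simps)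
  ultimately show ?t1 by simp
  have "((\<lambda>x. (B x * U x + A x * V x) / ((A x)\<^sup>2 + (B x)\<^sup>2)) has_derivative
      (\<lambda>h. (B' h * U x + B x * U' h + A' h * V x + A x * V' h - r * (2 * A x * A' h + 2 * B x * B'
          h)) / R)) (at x)"
    using R by (auto intro!: derivative_eq_intros assms simp: r_def fun_eq_iff field_simps
        power2_eq_square)
  moreover have "B' h * U x + B x * U' h + A' h * V x + A x * V' h - r * (2 * A x * A' h + 2 * B x
      * B' h)
     = B x * c h + A x * d h" for h
    unfolding UV c_def d_def by (simp add: algebra_simps)
  ultimately show ?t2 by simp
qed

text \<open>\<open>D\<close> is the derivative of \<open>elliptic_coords\<close>: \<open>c\<close> and \<open>d\<close> come from differentiating
  \<open>P = Dq(x)\<^sup>T p\<close> implicitly, and what is left of the form is antisymmetric because the second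
  derivative \<open>C + i S\<close> of \<open>q\<close> is symmetric.\<close>

lemma symplectic_cotangent_lift:
  fixes A B C S p r :: real
  assumes "A\<^sup>2 + B\<^sup>2 \<noteq> 0"
  defines "dA \<equiv> \<lambda>u :: phase. C * fst (fst u) - S * snd (fst u)"
    and "dB \<equiv> \<lambda>u :: phase. S * fst (fst u) + C * snd (fst u)"
  defines "c \<equiv> \<lambda>u. fst (snd u) - p * dA u - r * dB u"
    and "d \<equiv> \<lambda>u. snd (snd u) - r * dA u + p * dB u"
  defines "D \<equiv> \<lambda>u. ((A * fst (fst u) - B * snd (fst u), B * fst (fst u) + A * snd (fst u)),
     ((A * c u - B * d u) / (A\<^sup>2 + B\<^sup>2), (B * c u + A * d u) / (A\<^sup>2 + B\<^sup>2)))"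
  shows "symplectic_form (D u) (D v) = symplectic_form u v"
proof -
  define R where "R = A\<^sup>2 + B\<^sup>2"
  have R: "R \<noteq> 0" "R = A * A + B * B" using assms(1) by (simp_all add: R_def power2_eq_square)
  \<comment> \<open>Positions and momenta are both multiplied by \<open>A + i B\<close>, which
    scales inner products by \<open>R\<close> and so cancels the division by
    \<open>R\<close>.\<close>
  have *: "fst (D u) \<bullet> snd (D v) = fst (fst u) * c v + snd (fst u) * d v" for u v
  proof -
    have "fst (D u) \<bullet> snd (D v) = ((A * fst (fst u) - B * snd (fst u)) * (A * c v - B * d v) +
       (B * fst (fst u) + A * snd (fst u)) * (B * c v + A * d v)) / R"
      by (simp add: D_def R_def flip: add_divide_distrib)
    also have "\<dots> = (R * (fst (fst u) * c v + snd (fst u) * d v)) / R"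
      unfolding R(2) by (simp add: algebra_simps)
    finally show ?thesis using R(1) by simp
  qed
  have "symplectic_form (D u) (D v) = fst (D u) \<bullet> snd (D v) - fst (D v) \<bullet> snd (D u)"
    by (simp add: symplectic_form_def inner_commute)
  also have "\<dots> = symplectic_form u v"
    unfolding * c_def d_def dA_def dB_def
    by (simp add: symplectic_form_def inner_prod_def algebra_simps)
  finally show ?thesis .
qed

lemma elliptic_coords_symplectic: "symplectic_on elliptic_domain elliptic_coords"
proof -
  \<comment> \<open>The projections are linear and thus their own derivatives, so they are applied
    below to base points and to tangent vectors alike.\<close>
  define l n :: "phase \<Rightarrow> real" where "l = (\<lambda>x. fst (fst x))" and "n = (\<lambda>x. snd (fst x))"
  define pl pn :: "phase \<Rightarrow> real" where "pl = (\<lambda>x. fst (snd x))" and "pn = (\<lambda>x. snd (snd x))"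
  define A B where "A = (\<lambda>x. ell_A (l x) (n x))" and "B = (\<lambda>x. ell_B (l x) (n x))"
  define C S where "C = (\<lambda>x. cosh (l x) * cos (n x) / 2)" and "S = (\<lambda>x. sinh (l x) * sin (n x) / 2)"
  define R where "R = (\<lambda>x. (A x)\<^sup>2 + (B x)\<^sup>2)"
  define p r where "p = (\<lambda>x. (A x * pl x - B x * pn x) / R x)"
    and "r = (\<lambda>x. (B x * pl x + A x * pn x) / R x)"
  define dA dB where "dA = (\<lambda>x u. C x * l u - S x * n u)" and "dB = (\<lambda>x u. S x * l u + C x * n u)"
  define c d where "c = (\<lambda>x u. pl u - p x * dA x u - r x * dB x u)"
    and "d = (\<lambda>x u. pn u - r x * dA x u + p x * dB x u)"
  define D where "D = (\<lambda>x u. ((A x * l u - B x * n u, B x * l u + A x * n u),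
     ((A x * c x u - B x * d x u) / R x, (B x * c x u + A x * d x u) / R x)))"
  have coords_der [derivative_intros]: "(l has_derivative l) (at x)" "(n has_derivative n) (at x)"
    "(pl has_derivative pl) (at x)" "(pn has_derivative pn) (at x)" for x
    unfolding l_def n_def pl_def pn_def by (auto intro!: derivative_eq_intros)
  have coords_cont [continuous_intros]: "continuous_on T l" "continuous_on T n" "continuous_on T
      pl" "continuous_on T pn" for T
    unfolding l_def n_def pl_def pn_def by (intro continuous_intros)+
  have AB_cont [continuous_intros]: "continuous_on T A" "continuous_on T B" "continuous_on T C"
      "continuous_on T S" for T
    unfolding A_def B_def C_def S_def ell_A_def ell_B_def by (intro continuous_intros; simp)+
  have R_cont [continuous_intros]: "continuous_on T R" for T
    unfolding R_def by (intro continuous_intros)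
  have dom: "x \<in> elliptic_domain \<longleftrightarrow> R x \<noteq> 0" for x
    using elliptic_domain_iff[of "l x" "n x" "snd x"] by (simp add: l_def n_def R_def A_def B_def)
  have op: "open elliptic_domain"
  proof -
    have "elliptic_domain = R -` (- {0})" using dom by auto
    then show ?thesis
      using continuous_on_open_vimage[of UNIV R] R_cont
        by (metis Int_UNIV_right open_UNIV open_delete open_Compl closed_singleton)
  qed
  have pr_cont [continuous_intros]: "continuous_on elliptic_domain p" "continuous_on
      elliptic_domain r"
    unfolding p_def r_def by (intro continuous_intros; simp add: dom)+
  have der: "(elliptic_coords has_derivative D x) (at x)" if "x \<in> elliptic_domain" for x
  proof -
    have A: "(A has_derivative dA x) (at x)" and B: "(B has_derivative dB x) (at x)"
      unfolding A_def B_def dA_def dB_def C_def S_def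
      by (rule has_derivative_ell_A has_derivative_ell_B coords_der)+
    have CS: "(C has_derivative (\<lambda>u. A x * l u - B x * n u)) (at x)" "(S has_derivative (\<lambda>u. B x *
        l u + A x * n u)) (at x)"
      unfolding C_def S_def A_def B_def
      by (rule has_derivative_cosh_cos has_derivative_sinh_sin coords_der)+
    have R0: "(A x)\<^sup>2 + (B x)\<^sup>2 \<noteq> 0" using that dom by (simp add: R_def)
    have "((\<lambda>x. ((C x, S x), (A x * pl x - B x * pn x) / ((A x)\<^sup>2 + (B x)\<^sup>2), (B x * pl x + A x *
        pn x) / ((A x)\<^sup>2 + (B x)\<^sup>2)))
       has_derivative D x) (at x)"
      unfolding D_def c_def d_def p_def r_def R_def
      by (intro has_derivative_Pair CS has_derivative_complex_quotient A B coords_der R0)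
    moreover have "((C y, S y), (A y * pl y - B y * pn y) / ((A y)\<^sup>2 + (B y)\<^sup>2), (B y * pl y + A y
        * pn y) / ((A y)\<^sup>2 + (B y)\<^sup>2)) = elliptic_coords y"
      if "y \<in> elliptic_domain" for y
      using elliptic_coords_eq[of "l y" "n y" "pl y" "pn y"] that
      by (simp add: A_def B_def C_def S_def l_def n_def pl_def pn_def elliptic_q_def split_beta)
    ultimately show ?thesis
      using has_derivative_transform_within_open[OF _ op that] by blast
  qed
  have bl: "blinfun_apply (Blinfun (D x)) = D x" if "x \<in> elliptic_domain" for x
    using bounded_linear_Blinfun_apply has_derivative_bounded_linear[OF der[OF that]] by blast
  \<comment> \<open>In finite dimension, continuity in operator norm follows from continuity on each
    fixed vector.\<close>
  have "continuous_on elliptic_domain (\<lambda>x. D x v)" for v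
    unfolding D_def c_def d_def dA_def dB_def by (intro continuous_intros; simp add: dom)
  then have "continuous_on elliptic_domain (\<lambda>x. Blinfun (D x))"
    by (intro continuous_on_blinfun_componentwise) (simp add: bl cong: continuous_on_cong)
  moreover have "symplectic_form (D x u) (D x v) = symplectic_form u v" if "x \<in> elliptic_domain"
    for x u v
    using symplectic_cotangent_lift[where A = "A x" and B = "B x" and C = "C x" and S = "S x"
      and p = "p x" and r = "r x" and u = u and v = v] that
    unfolding dom D_def c_def d_def dA_def dB_def R_def l_def n_def pl_def pn_def by simp
  ultimately show ?thesis
    unfolding symplectic_on_def by (intro exI[of _ "\<lambda>x. Blinfun (D x)"]) (simp add: bl der)
qed

section \<open>The Earth component\<close>

locale subcritical =
  fixes \<mu> c :: real
  assumes mu: "0 < \<mu>" "\<mu> < 1" and energy: "c < critical_energy \<mu>"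
begin

definition a :: real where "a = - c"
definition k :: real where "k = 1 - 2 * \<mu>"

definition f :: "real \<Rightarrow> real" where "f l = a * (cosh l)\<^sup>2 - 2 * cosh l"
definition g :: "real \<Rightarrow> real" where "g n = 2 * k * cos n - a * (cos n)\<^sup>2"
definition f1 :: "real \<Rightarrow> real" where "f1 l = 2 * sinh l * (a * cosh l - 1)"
definition g1 :: "real \<Rightarrow> real" where "g1 n = 2 * sin n * (a * cos n - k)"
definition f2 :: "real \<Rightarrow> real" where "f2 l = 4 * a * (cosh l)\<^sup>2 - 2 * cosh l - 2 * a"
definition g2 :: "real \<Rightarrow> real" where "g2 n = 4 * a * (cos n)\<^sup>2 - 2 * k * cos n - 2 * a"

text \<open>As a function of \<open>cos n\<close>, \<open>g\<close> is a concave parabola with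
  vertex \<open>k / a\<close>. The well is the side of this potential barrier that contains the
  Earth, \<open>n = pi\<close>.\<close>

definition well :: "phase set" where "well = {((l, n), P) | l n P. 0 < n \<and> n < 2 * pi \<and> a * cos n
    < k}"
definition body :: "phase set" where "body = {x \<in> well. regularized_Q \<mu> c x \<le> 0}"
definition interior_body :: "phase set" where "interior_body = {x \<in> well. regularized_Q \<mu> c x < 0}"
definition surface :: "phase set" where "surface = {x \<in> well. regularized_Q \<mu> c x = 0}"

lemma k_bound: "\<bar>k\<bar> < 1" using mu by (auto simp: k_def)

lemma critical_energy_eq: "critical_energy \<mu> = - (1 + sqrt (1 - k\<^sup>2))"
proof -
  have "1 - k\<^sup>2 = 4 * (\<mu> * (1 - \<mu>))" by (simp add: k_def power2_eq_square algebra_simps)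
  then have "sqrt (1 - k\<^sup>2) = 2 * sqrt (\<mu> * (1 - \<mu>))" by (simp add: real_sqrt_mult)
  then show ?thesis by (simp add: critical_energy_def)
qed

lemma a_gt: "1 + sqrt (1 - k\<^sup>2) < a" using energy by (simp add: a_def critical_energy_eq)

lemma k2: "k\<^sup>2 < 1" using k_bound by (simp add: abs_square_less_1)

lemma a_gt_1: "1 < a"
proof -
  have "0 < sqrt (1 - k\<^sup>2)" using k2 by simp
  then show ?thesis using a_gt by linarith
qed

lemma k_less_a: "\<bar>k\<bar> < a" using k_bound a_gt_1 by linarith

text \<open>\<open>1 + sqrt (1 - k^2)\<close> is the larger root of this quadratic in
  \<open>a\<close>. Divided by \<open>a\<close>, the quadratic is the value of
  \<open>f 0 + g\<close> on the barrier.\<close>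

lemma discriminant_pos: "0 < a\<^sup>2 - 2 * a + k\<^sup>2"
proof -
  have "sqrt (1 - k\<^sup>2) < a - 1" "0 \<le> sqrt (1 - k\<^sup>2)" using a_gt k2 by auto
  then have "(sqrt (1 - k\<^sup>2))\<^sup>2 < (a - 1)\<^sup>2" by (intro power_strict_mono) auto
  then have "1 - k\<^sup>2 < (a - 1)\<^sup>2" using k2 by simp
  then show ?thesis by (simp add: power2_diff)
qed

lemma Q_eq: "regularized_Q \<mu> c ((l, n), (pl, pn)) = 2 * (pl\<^sup>2 + pn\<^sup>2) + f l + g n"
  by (simp add: regularized_Q_def f_def g_def a_def k_def algebra_simps)

lemma Q_eq_proj: "regularized_Q \<mu> c x = 2 * ((fst (snd x))\<^sup>2 + (snd (snd x))\<^sup>2) + f (fst (fst x))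
    + g (snd (fst x))"
  using Q_eq by (metis prod.collapse)

lemma well_iff: "x \<in> well \<longleftrightarrow> 0 < snd (fst x) \<and> snd (fst x) < 2 * pi \<and> a * cos (snd (fst x)) < k"
  by (cases x) (auto simp: well_def)

section \<open>Monotonicity of the separated potentials and the star-shaped body\<close>

lemma f_strict_mono: "\<bar>l'\<bar> < \<bar>l\<bar> \<Longrightarrow> f l' < f l"
proof -
  assume "\<bar>l'\<bar> < \<bar>l\<bar>"
  then have "cosh \<bar>l'\<bar> < cosh \<bar>l\<bar>" by (subst cosh_real_nonneg_less_iff) auto
  then have u: "cosh l' < cosh l" by simp
  have "cosh l' \<ge> 1" by (rule cosh_real_ge_1)
  then have "2 < cosh l + cosh l'" using u by linarith
  then have "2 < a * (cosh l + cosh l')"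
    using a_gt_1 mult_strict_mono[of 1 a 2 "cosh l + cosh l'"] by simp
  then have "0 < (cosh l - cosh l') * (a * (cosh l + cosh l') - 2)" using u by simp
  also have "\<dots> = f l - f l'" by (simp add: f_def power2_eq_square algebra_simps)
  finally show ?thesis by simp
qed

lemma f_mono: "\<bar>l'\<bar> \<le> \<bar>l\<bar> \<Longrightarrow> f l' \<le> f l"
proof (cases "\<bar>l'\<bar> < \<bar>l\<bar>")
  case False
  assume "\<bar>l'\<bar> \<le> \<bar>l\<bar>"
  with False have "\<bar>l'\<bar> = \<bar>l\<bar>" by simp
  then have "cosh l' = cosh l" by (metis cosh_real_abs)
  then show ?thesis unfolding f_def by (simp only: order_refl)
qed (auto dest: f_strict_mono)

lemma f_0: "f 0 = a - 2" by (simp add: f_def)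

lemma f_ge: "a - 2 \<le> f l" using f_mono[of 0 l] f_0 by simp

lemma g_strict_mono: "cos n' < cos n \<Longrightarrow> a * cos n < k \<Longrightarrow> g n' < g n"
proof -
  assume 1: "cos n' < cos n" "a * cos n < k"
  have "a * cos n' < a * cos n" using 1 a_gt_1 by simp
  then have "0 < (cos n - cos n') * (2 * k - a * cos n - a * cos n')" using 1 by simp
  also have "\<dots> = g n - g n'" by (simp add: g_def power2_eq_square algebra_simps)
  finally show ?thesis by simp
qed

lemma g_mono: "cos n' \<le> cos n \<Longrightarrow> a * cos n < k \<Longrightarrow> g n' \<le> g n"
  using g_strict_mono[of n' n] by (cases "cos n' = cos n") (auto simp: g_def)

text \<open>Consequently the sublevel set of \<open>regularized_Q\<close> avoids the barrier. This
  makes \<open>body\<close> closed and isolates the surface from the rest of the zero set.\<close>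

lemma potential_pos_at_barrier: "a * cos n = k \<Longrightarrow> 0 < f l + g n"
proof -
  assume n: "a * cos n = k"
  have "a * g n = 2 * k * (a * cos n) - (a * cos n)\<^sup>2"
    by (simp add: g_def power2_eq_square algebra_simps)
  then have "a * g n = k\<^sup>2" unfolding n by (simp add: power2_eq_square)
  then have "a * (a - 2 + g n) = a\<^sup>2 - 2 * a + k\<^sup>2" by (simp add: power2_eq_square algebra_simps)
  then have "0 < a - 2 + g n" using discriminant_pos a_gt_1
    by (metis zero_less_mult_pos less_trans zero_less_one)
  then show ?thesis using f_ge[of l] by simp
qed

text \<open>\<open>cos n = - cos \<bar>n - pi\<bar>\<close>, and \<open>cos\<close> decreases on
  \<open>[0, pi]\<close>. Contracting towards \<open>pi\<close> therefore lowers
  \<open>cos n\<close>, and with it \<open>g\<close>.\<close>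

lemma cos_scale_pi:
  assumes "0 < n" "n < 2 * pi" "0 \<le> t" "t < 1"
  shows "cos (pi + t * (n - pi)) \<le> cos n" "n \<noteq> pi \<Longrightarrow> cos (pi + t * (n - pi)) < cos n"
proof -
  have 1: "cos (pi + t * (n - pi)) = - cos (t * \<bar>n - pi\<bar>)" "cos n = - cos \<bar>n - pi\<bar>"
    by (simp_all add: cos_add cos_diff abs_if) (metis cos_minus minus_diff_eq mult_minus_right)
  have b: "\<bar>n - pi\<bar> \<le> pi" using assms by (simp add: abs_if)
  have t: "t * \<bar>n - pi\<bar> \<le> \<bar>n - pi\<bar>" using assms mult_right_mono[of t 1 "\<bar>n - pi\<bar>"] by simp
  show "cos (pi + t * (n - pi)) \<le> cos n"
    unfolding 1 neg_le_iff_le using b t assms(3) by (intro cos_monotone_0_pi_le) auto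
  assume "n \<noteq> pi"
  then have "t * \<bar>n - pi\<bar> < \<bar>n - pi\<bar>" using assms mult_strict_right_mono[of t 1 "\<bar>n - pi\<bar>"] by simp
  then show "cos (pi + t * (n - pi)) < cos n"
    unfolding 1 neg_less_iff_less using b assms(3) by (intro cos_monotone_0_pi) auto
qed

text \<open>The minimum of \<open>regularized_Q\<close> in the well.\<close>

definition center :: phase where "center = ((0, pi), (0, 0))"

lemma Q_center: "regularized_Q \<mu> c center < 0"
  using k_bound by (simp add: center_def Q_eq f_def g_def)

lemma center_in_interior_body: "center \<in> interior_body"
  using Q_center k_less_a by (simp add: interior_body_def well_iff) (simp add: center_def)

text \<open>Contraction to the centre raises none of the kinetic term, \<open>f\<close> and
  \<open>g\<close>, and strictly lowers each of them that is not already at its central value; for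
  \<open>x \<noteq> center\<close> at least one is not.\<close>

lemma body_starlike: assumes "x \<in> body" shows "open_segment center x \<subseteq> interior_body"
proof
  fix z assume "z \<in> open_segment center x"
  then obtain t where t: "0 < t" "t < 1" and zt: "z = (1 - t) *\<^sub>R center + t *\<^sub>R x"
    and ne: "center \<noteq> x"
    by (auto simp: in_segment)
  obtain l n pl pn where x: "x = ((l, n), (pl, pn))" by (metis surj_pair)
  have z: "z = ((t * l, pi + t * (n - pi)), (t * pl, t * pn))"
    unfolding zt x center_def by (simp add: algebra_simps)
  have xb: "0 < n" "n < 2 * pi" "a * cos n < k" "2 * (pl\<^sup>2 + pn\<^sup>2) + f l + g n \<le> 0"
    using assms by (simp_all add: body_def well_iff x Q_eq)
  have t2: "t\<^sup>2 < 1" using t by (simp add: power_less_one_iff)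
  have cosn: "cos (pi + t * (n - pi)) \<le> cos n" "n \<noteq> pi \<Longrightarrow> cos (pi + t * (n - pi)) < cos n"
    using cos_scale_pi[of n t] xb t by auto
  have wz: "z \<in> well"
  proof -
    have "0 < pi + t * (n - pi)"
    proof -
      have "0 < (1 - t) * pi + t * n" using t xb by (intro add_pos_pos mult_pos_pos) auto
      then show ?thesis by (simp add: algebra_simps)
    qed
    moreover have "pi + t * (n - pi) < 2 * pi"
    proof -
      have "0 < (1 - t) * pi + t * (2 * pi - n)" using t xb by (intro add_pos_pos mult_pos_pos) auto
      then show ?thesis by (simp add: algebra_simps)
    qed
    moreover have "a * cos (pi + t * (n - pi)) < k"
      using cosn(1) xb(3) a_gt_1 by (smt (verit) mult_left_mono)
    ultimately show ?thesis by (simp add: well_iff z)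
  qed
  have K: "(t * pl)\<^sup>2 + (t * pn)\<^sup>2 = t\<^sup>2 * (pl\<^sup>2 + pn\<^sup>2)"
    by (simp add: power_mult_distrib algebra_simps)
  have K1: "(t * pl)\<^sup>2 + (t * pn)\<^sup>2 \<le> pl\<^sup>2 + pn\<^sup>2"
    unfolding K using t2 mult_right_mono[of "t\<^sup>2" 1 "pl\<^sup>2 + pn\<^sup>2"] by simp
  have K2: "(t * pl)\<^sup>2 + (t * pn)\<^sup>2 < pl\<^sup>2 + pn\<^sup>2" if "(pl, pn) \<noteq> (0, 0)"
  proof -
    have "0 < pl\<^sup>2 + pn\<^sup>2" using that by (auto simp: sum_power2_gt_zero_iff)
    then show ?thesis unfolding K using t2 mult_strict_right_mono[of "t\<^sup>2" 1 "pl\<^sup>2 + pn\<^sup>2"] by simp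
  qed
  have F1: "f (t * l) \<le> f l"
    by (rule f_mono) (use t in \<open>simp add: abs_mult mult_left_le_one_le\<close>)
  have F2: "f (t * l) < f l" if "l \<noteq> 0"
    by (rule f_strict_mono) (use t that in \<open>simp add: abs_mult\<close>)
  have G1: "g (pi + t * (n - pi)) \<le> g n" by (rule g_mono[OF cosn(1) xb(3)])
  have G2: "g (pi + t * (n - pi)) < g n" if "n \<noteq> pi"
    by (rule g_strict_mono[OF cosn(2)[OF that] xb(3)])
  have "regularized_Q \<mu> c z < regularized_Q \<mu> c x"
    unfolding x z Q_eq using ne K1 K2 F1 F2 G1 G2 by (force simp: x center_def)
  then show "z \<in> interior_body" using wz xb by (simp add: interior_body_def x Q_eq)
qed

section \<open>Topology of the body and its boundary\<close>

lemma Q_continuous: "continuous_on T (regularized_Q \<mu> c)"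
  unfolding regularized_Q_def split_beta by (intro continuous_intros)

text \<open>Weak inequalities add no points: \<open>cos n = 1\<close> violates
  \<open>a * cos n \<le> k\<close>, and on the barrier \<open>regularized_Q\<close> is positive.
  This gives closedness of \<open>body\<close>.\<close>

lemma body_alt: "body = {x. 0 \<le> snd (fst x) \<and> snd (fst x) \<le> 2 * pi \<and> a * cos (snd (fst x)) \<le> k \<and>
    regularized_Q \<mu> c x \<le> 0}"
proof (intro set_eqI iffI CollectI)
  fix x :: phase
  assume "x \<in> {x. 0 \<le> snd (fst x) \<and> snd (fst x) \<le> 2 * pi \<and> a * cos (snd (fst x)) \<le> k \<and>
      regularized_Q \<mu> c x \<le> 0}"
  then have x: "0 \<le> snd (fst x)" "snd (fst x) \<le> 2 * pi" "a * cos (snd (fst x)) \<le> k" "regularized_Q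
      \<mu> c x \<le> 0" by auto
  have "snd (fst x) \<noteq> 0" "snd (fst x) \<noteq> 2 * pi" using x(3) k_less_a by auto
  moreover have "a * cos (snd (fst x)) \<noteq> k"
  proof
    assume "a * cos (snd (fst x)) = k"
    from potential_pos_at_barrier[OF this, of "fst (fst x)"] show False using x(4)
      by (simp add: Q_eq_proj add.assoc) (smt (verit) sum_power2_ge_zero)
  qed
  ultimately show "x \<in> body" using x by (simp add: body_def well_iff)
qed (auto simp: body_def well_iff)

lemma body_compact: "compact body"
proof -
  have "closed body"
    unfolding body_alt by (intro closed_Collect_conj closed_Collect_le continuous_intros
        Q_continuous)
  \<comment> \<open>From \<open>f l \<ge> a - 2\<close> and \<open>g n \<ge> - a - 2\<close> follow
    \<open>|p|^2 \<le> 2\<close> and \<open>f l \<le> a + 2\<close>. The latter forces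
    \<open>cosh l < 3\<close>, and \<open>(1 + \<bar>l\<bar>) / 2 \<le> cosh l\<close> then bounds
    \<open>l\<close> by 5.\<close>
  moreover have "body \<subseteq> ({-5..5} \<times> {0..2*pi}) \<times> ({-2..2} \<times> {-2..2})"
  proof
    fix x assume "x \<in> body"
    moreover obtain l n pl pn where x: "x = ((l, n), (pl, pn))" by (metis surj_pair)
    ultimately have b: "0 < n" "n < 2 * pi" "2 * pl\<^sup>2 + 2 * pn\<^sup>2 + f l + g n \<le> 0"
      by (simp_all add: body_def well_iff Q_eq)
    have "(cos n)\<^sup>2 \<le> 1" by (simp add: abs_square_le_1)
    then have "a * (cos n)\<^sup>2 \<le> a" using a_gt_1 by simp
    moreover have "\<bar>k * cos n\<bar> \<le> 1" unfolding abs_mult using k_bound by (intro mult_le_one) auto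
    ultimately have g: "g n \<ge> - a - 2" by (simp add: g_def)
    have "pl\<^sup>2 + pn\<^sup>2 \<le> 2" using b(3) f_ge[of l] g by linarith
    then have "pl\<^sup>2 \<le> 4" "pn\<^sup>2 \<le> 4" using zero_le_power2[of pl] zero_le_power2[of pn] by linarith+
    then have p: "\<bar>pl\<bar> \<le> 2" "\<bar>pn\<bar> \<le> 2" using abs_le_square_iff[of pl 2] abs_le_square_iff[of pn 2]
      by auto
    have "f l \<le> a + 2" using b(3) g sum_power2_ge_zero[of pl pn] by linarith
    moreover have "3 \<le> cosh l \<Longrightarrow> a + 2 < f l"
    proof -
      assume u: "3 \<le> cosh l"
      have "3 * (3 * a - 2) \<le> cosh l * (a * cosh l - 2)"
        using u a_gt_1 mult_left_mono[of 3 "cosh l" a] by (intro mult_mono) auto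
      then show "a + 2 < f l" using a_gt_1 by (simp add: f_def power2_eq_square algebra_simps)
    qed
    ultimately have u: "cosh l < 3" by linarith
    have "1 + \<bar>l\<bar> \<le> exp \<bar>l\<bar>" by (rule exp_ge_add_one_self)
    moreover have "exp \<bar>l\<bar> / 2 \<le> cosh l" by (simp add: cosh_field_def abs_if)
    ultimately have "\<bar>l\<bar> \<le> 5" using u by linarith
    then show "x \<in> ({-5..5} \<times> {0..2*pi}) \<times> ({-2..2} \<times> {-2..2})" using b p by (auto simp: x)
  qed
  then have "bounded body"
    by (rule bounded_subset[rotated]) (intro bounded_Times bounded_closed_interval)
  ultimately show ?thesis by (simp add: compact_eq_bounded_closed)
qed

lemma well_open: "open well"
proof -
  have "well = {x. 0 < snd (fst x) \<and> snd (fst x) < 2 * pi \<and> a * cos (snd (fst x)) < k}"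
    using well_iff by auto
  then show ?thesis by (auto intro!: open_Collect_conj open_Collect_less continuous_intros)
qed

lemma interior_body_open: "open interior_body"
proof -
  have "interior_body = well \<inter> {x. regularized_Q \<mu> c x < 0}" by (auto simp: interior_body_def)
  then show ?thesis using well_open
    by (auto intro!: open_Int open_Collect_less Q_continuous continuous_intros)
qed

lemma surface_eq: "surface = body - interior_body"
  by (auto simp: surface_def body_def interior_body_def)

lemma interior_body_subset: "interior_body \<subseteq> body"
  by (auto simp: body_def interior_body_def)

lemma body_geometry: "frontier interior_body = surface" "connected surface" "connected
    interior_body"
  unfolding surface_eq
  by (rule frontier_starlike_body[where a = center] connected_frontier_starlike_body[where a =
      center] connected_interior_starlike_body[where a = center] body_compact interior_body_open
          interior_body_subset center_in_interior_body body_starlike | simp)+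

lemma surface_compact: "compact surface"
  using body_geometry(1) body_compact interior_body_subset bounded_subset compact_imp_bounded
      compact_frontier_bounded by metis

text \<open>The kinetic term \<open>2 (1 + k)\<close> cancels the potential
  \<open>f 0 + g pi = - 2 - 2 k\<close>.\<close>

lemma point_over_earth_in_surface: "((0, pi), (sqrt (1 + k), 0)) \<in> surface"
  using k_bound k_less_a by (simp add: surface_def well_iff Q_eq f_def g_def)

lemma surface_nonempty: "surface \<noteq> {}"
  using point_over_earth_in_surface by blast

section \<open>Identification with the component on the cylinder\<close>

lemma wrap_continuous: "continuous_on T wrap"
  unfolding wrap_def split_beta by (intro continuous_intros)

lemma wrap_surface: "wrap ` surface = wrap ` {x. regularized_Q \<mu> c x = 0} \<inter> {z. a * Re (snd (fst
    z)) < k}"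
proof (intro equalityI subsetI)
  fix z assume "z \<in> wrap ` surface"
  then obtain x where x: "z = wrap x" "x \<in> well" "regularized_Q \<mu> c x = 0"
    by (auto simp: surface_def)
  then have "a * Re (snd (fst z)) < k" by (cases x) (auto simp: well_iff wrap_def)
  then show "z \<in> wrap ` {x. regularized_Q \<mu> c x = 0} \<inter> {z. a * Re (snd (fst z)) < k}"
    using x by blast
next
  fix z assume z: "z \<in> wrap ` {x. regularized_Q \<mu> c x = 0} \<inter> {z. a * Re (snd (fst z)) < k}"
  then obtain l n P where x: "z = wrap ((l, n), P)" "regularized_Q \<mu> c ((l, n), P) = 0" by auto
  then have n: "a * cos n < k" using z by (auto simp: wrap_def)
  obtain m where m: "0 \<le> m" "m < 2 * pi" "cos n = cos m" "sin n = sin m"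
    using sincos_total_2pi[of "cos n" "sin n"] by (metis sin_cos_squared_add2)
  \<comment> \<open>The angle missing from the chart \<open>0 < n < 2 * pi\<close> lies outside the
    well.\<close>
  have "m \<noteq> 0" using n m(3) k_less_a by auto
  then have "((l, m), P) \<in> surface" using m x(2) n
    by (cases P) (auto simp: surface_def well_iff Q_eq g_def)
  moreover have "wrap ((l, m), P) = z" using m by (simp add: x wrap_def complex_eq_iff)
  ultimately show "z \<in> wrap ` surface" by blast
qed

text \<open>No zero lies on the barrier, so the strict and the weak barrier inequality cut out the
  same part of the zero set: a clopen part, which is also connected.\<close>

lemma wrap_surface_component: "wrap ` surface \<in> components (wrap ` {x. regularized_Q \<mu> c x = 0})"
proof -
  let ?Z = "wrap ` {x. regularized_Q \<mu> c x = 0}"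
  have conn: "connected (wrap ` surface)"
    by (intro connected_continuous_image wrap_continuous body_geometry)
  have "a * Re (snd (fst z)) \<noteq> k" if zZ: "z \<in> ?Z" for z
  proof
    assume z: "a * Re (snd (fst z)) = k"
    obtain x where x: "z = wrap x" "regularized_Q \<mu> c x = 0" using zZ by blast
    obtain l n pl pn where x': "x = ((l, n), (pl, pn))" by (metis surj_pair)
    have "a * cos n = k" using z unfolding x(1) x' by (simp add: wrap_def)
    from potential_pos_at_barrier[OF this, of l] show False
      using x(2) zero_le_power2[of pl] zero_le_power2[of pn] unfolding x' Q_eq distrib_left
        by linarith
  qed
  then have "wrap ` surface = ?Z \<inter> {z. a * Re (snd (fst z)) \<le> k}"
    unfolding wrap_surface less_le by blast
  moreover have "closed {z :: (real \<times> complex) \<times> plane. a * Re (snd (fst z)) \<le> k}"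
    by (intro closed_Collect_le continuous_intros)
  ultimately have cl: "closedin (top_of_set ?Z) (wrap ` surface)" by (metis closedin_closed_Int)
  have "open {z :: (real \<times> complex) \<times> plane. a * Re (snd (fst z)) < k}"
    by (intro open_Collect_less continuous_intros)
  then have op: "openin (top_of_set ?Z) (wrap ` surface)" unfolding wrap_surface
    by (metis openin_open_Int)
  have sub: "wrap ` surface \<subseteq> ?Z" unfolding wrap_surface by blast
  obtain C where C: "C \<in> components ?Z" "wrap ` surface \<subseteq> C"
    using exists_component_superset[OF sub _ conn] surface_nonempty sub by blast
  have "connected C" "C \<subseteq> ?Z" using C(1)
    by (simp_all add: in_components_connected in_components_subset)
  moreover have "closedin (top_of_set C) (wrap ` surface)" "openin (top_of_set C) (wrap ` surface)"
    using cl op C(2) \<open>C \<subseteq> ?Z\<close> by (auto intro: closedin_subset_trans openin_subset_trans)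
  ultimately have "wrap ` surface = C" using surface_nonempty unfolding connected_clopen by blast
  then show ?thesis using C(1) by simp
qed

lemma earth_component_cylinder_eq: "earth_component_cylinder \<mu> c = wrap ` surface"
  unfolding earth_component_cylinder_def
proof (rule the_equality)
  let ?Z = "wrap ` {x. regularized_Q \<mu> c x = 0}"
  have "(0, cis pi) \<in> fst ` wrap ` surface"
    using point_over_earth_in_surface by (force simp: wrap_def)
  then show "wrap ` surface \<in> components ?Z \<and> (0, cis pi) \<in> fst ` wrap ` surface"
    using wrap_surface_component by simp
  fix C assume C: "C \<in> components ?Z \<and> (0, cis pi) \<in> fst ` C"
  then obtain P where P: "((0, cis pi), P) \<in> C" by auto
  then have "((0, cis pi), P) \<in> ?Z" using C in_components_subset by blast
  then have "((0, cis pi), P) \<in> wrap ` surface" unfolding wrap_surface using k_less_a by auto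
  then show "C = wrap ` surface" using components_eq[OF conjunct1[OF C] wrap_surface_component] P
    by blast
qed

lemma regularized_earth_component_eq: "regularized_earth_component \<mu> c = surface"
proof (intro equalityI subsetI)
  fix x assume "x \<in> regularized_earth_component \<mu> c"
  then obtain l n P where x: "x = ((l, n), P)" "0 < n" "n < 2 * pi" "wrap ((l, n), P) \<in> wrap `
      surface"
    by (auto simp: regularized_earth_component_def earth_component_cylinder_eq)
  then obtain n' where n': "cis n = cis n'" "((l, n'), P) \<in> surface" by (auto simp: wrap_def)
  have "cos n = cos n'" using n'(1) by (simp add: complex_eq_iff)
  then show "x \<in> surface" using n'(2) x by (cases P) (auto simp: surface_def well_iff Q_eq g_def)
next
  fix x assume "x \<in> surface"
  then show "x \<in> regularized_earth_component \<mu> c"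
    unfolding regularized_earth_component_def earth_component_cylinder_eq
    by (cases x) (auto simp: surface_def well_def)
qed

end

section \<open>The convexity expression on the symmetry segment\<close>

text \<open>\<open>excess a k (- cos n)\<close> is \<open>g'\<^sup>2 - 2 (f 0 + g) g''\<close> at \<open>n\<close>, the convexity expression on the
  segment \<open>l = 0\<close>; \<open>excess_min k a\<close> is its value at the interior critical point \<open>- k / (4 a)\<close>.\<close>

definition excess :: "real \<Rightarrow> real \<Rightarrow> real \<Rightarrow> real" where
  "excess a k y = 4 * (1 - y\<^sup>2) * (a * y + k)\<^sup>2 +
     2 * (a * y\<^sup>2 + 2 * k * y - a + 2) * (4 * a * y\<^sup>2 + 2 * k * y - 2 * a)"

lemma excess_deriv:
  "(excess a k has_real_derivative 4 * (a * y\<^sup>2 + 2 * k * y - a + 2) * (4 * a * y + k)) (at y)"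
  unfolding excess_def
  by (rule derivative_eq_intros refl)+ (simp add: power2_eq_square algebra_simps)

definition excess_min :: "real \<Rightarrow> real \<Rightarrow> real" where
  "excess_min k a = 4 * a\<^sup>2 - 8 * a + 9 * k\<^sup>2 / 2 - k\<^sup>2 / a + 5 * (k\<^sup>2 / a)\<^sup>2 / 64"

lemma excess_at_min: "a \<noteq> 0 \<Longrightarrow> excess a k (- k / (4 * a)) = excess_min k a"
  by (simp add: excess_def excess_min_def field_simps power2_eq_square)

text \<open>In the well \<open>q\<close> increases from a negative value at the barrier, so the Hill
  region is an interval beginning at the zero of \<open>q\<close>. There \<open>q \<ge> 0\<close>,
  and moving \<open>y\<close> towards \<open>m\<close> does not increase \<open>excess\<close>; the
  motion ends at \<open>m\<close> or at the zero of \<open>q\<close>, whichever comes first.\<close>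

lemma excess_pos:
  assumes a: "\<bar>k\<bar> < a" and k: "\<bar>k\<bar> < 1" and disc: "0 < a\<^sup>2 - 2 * a + k\<^sup>2"
    and y: "- k < a * y" "y \<le> 1" and h: "0 \<le> a * y\<^sup>2 + 2 * k * y - a + 2"
    and crit: "0 < k \<Longrightarrow> 0 < excess_min k a"
  shows "0 < excess a k y"
proof -
  \<comment> \<open>For \<open>y = - cos n\<close> this is \<open>- (f 0 + g n)\<close>.\<close>
  define q where "q = (\<lambda>y. a * y\<^sup>2 + 2 * k * y - a + 2)"
  have a0: "0 < a" using a by linarith
  have q_mono: "q u \<le> q v" if "- k \<le> a * u" "u \<le> v" for u v
  proof -
    have "a * u \<le> a * v" using that a0 by simp
    then have "0 \<le> (v - u) * (a * u + a * v + 2 * k)" using that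
      by (intro mult_nonneg_nonneg) linarith+
    also have "\<dots> = q v - q u" by (simp add: q_def power2_eq_square algebra_simps)
    finally show ?thesis by simp
  qed
  have q_left: "q (- k / a) < 0"
  proof -
    have "a * q (- k / a) = - (a\<^sup>2 - 2 * a + k\<^sup>2)"
      using a0 by (simp add: q_def field_simps power2_eq_square)
    then show ?thesis using disc a0
      by (metis neg_less_0_iff_less zero_less_mult_iff mult_less_0_iff not_less_iff_gr_or_eq)
  qed
  have ky: "- k / a < y" using y(1) a0 by (simp add: field_simps)
  define m where "m = - k / (4 * a)"
  have der: "(excess a k has_real_derivative 4 * q y * (4 * a * y + k)) (at y)" for y
    using excess_deriv by (simp add: q_def)
  show ?thesis
  proof (cases "m \<le> y")
    case True
    have up: "excess a k u \<le> excess a k y" if u: "- k / a \<le> u" "m \<le> u" "u \<le> y" "0 \<le> q u" for u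
    proof (rule DERIV_nonneg_imp_nondecreasing[OF u(3)])
      fix v assume v: "u \<le> v" "v \<le> y"
      have "- k \<le> a * u" using u(1) a0 by (simp add: field_simps)
      then have "0 \<le> q v" using q_mono[of u v] v u(4) by simp
      moreover have "0 \<le> 4 * a * v + k"
      proof -
        have "- k \<le> 4 * a * u" using u(2) a0 by (simp add: m_def field_simps)
        also have "\<dots> \<le> 4 * a * v" using v a0 by simp
        finally show ?thesis by simp
      qed
      ultimately show "\<exists>d. (excess a k has_real_derivative d) (at v) \<and> 0 \<le> d"
        using der by (intro exI[of _ "4 * q v * (4 * a * v + k)"]) simp
    qed
    show ?thesis
    proof (cases "q (max m (- k / a)) \<le> 0")
      case True
      have "\<exists>u\<ge>max m (- k / a). u \<le> y \<and> q u = 0"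
        by (rule IVT'[of q _ 0]) (use True h ky \<open>m \<le> y\<close> in \<open>auto simp: q_def intro!:
            continuous_intros\<close>)
      then obtain u where u: "max m (- k / a) \<le> u" "u \<le> y" "q u = 0" by blast
      then have "u \<noteq> - k / a" using q_left by auto
      then have "- k / a < u" using u by auto
      then have "- k < a * u" using a0 by (simp add: field_simps)
      then have au: "0 < a * u + k" by simp
      \<comment> \<open>\<open>q 1 = 2 + 2 k\<close> is positive.\<close>
      have "u \<noteq> 1" using u(3) k by (auto simp: q_def)
      then have "u < 1" using u(2) y(2) by simp
      moreover have "- 1 < u"
      proof -
        have "a * (- 1) < a * u" using au a by linarith
        then show ?thesis using mult_less_cancel_left_pos[OF a0, of "- 1" u] by simp
      qed
      ultimately have "u\<^sup>2 < 1" by (simp add: abs_square_less_1)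
      then have "0 < 4 * (1 - u\<^sup>2) * (a * u + k)\<^sup>2" using au by simp
      also have "\<dots> = excess a k u" using u(3) by (simp add: excess_def q_def)
      also have "\<dots> \<le> excess a k y" using up[of u] u by simp
      finally show ?thesis .
    next
      case False
      \<comment> \<open>\<open>q\<close> is negative at \<open>- k / a\<close>, so the maximum is
        \<open>m\<close>. That \<open>m\<close> lies inside the well means \<open>k > 0\<close>, the
        case in which \<open>crit\<close> applies.\<close>
      then have "m > - k / a" "0 < q m" using q_left by (auto simp: max_def split: if_splits)
      then have "0 < k" using a0 by (simp add: m_def field_simps)
      then have "0 < excess a k m" using crit excess_at_min[of a k] a0 by (simp add: m_def)
      also have "\<dots> \<le> excess a k y" using up[of m] \<open>m > - k / a\<close> \<open>0 < q m\<close> True by simp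
      finally show ?thesis .
    qed
  next
    case False
    then have "- k / a < m" using ky by simp
    then have "0 < k" using a0 by (simp add: m_def field_simps)
    then have "0 < excess a k m" using crit excess_at_min[of a k] a0 by (simp add: m_def)
    also have "\<dots> \<le> excess a k y"
    proof (rule DERIV_nonpos_imp_nonincreasing[of y m "excess a k"])
      show "y \<le> m" using False by simp
      fix v assume v: "y \<le> v" "v \<le> m"
      have "0 \<le> q v" using q_mono[of y v] v y(1) h by (simp add: q_def)
      moreover have "4 * a * v + k \<le> 0"
      proof -
        have "4 * a * v \<le> 4 * a * m" using v a0 by simp
        then show ?thesis using a0 by (simp add: m_def)
      qed
      ultimately show "\<exists>d. (excess a k has_real_derivative d) (at v) \<and> d \<le> 0"
        using der by (intro exI[of _ "4 * q v * (4 * a * v + k)"]) (simp add: mult_nonneg_nonpos)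
    qed
    finally show ?thesis .
  qed
qed

text \<open>\<open>a^2 - 2 a\<close> increases for \<open>a \<ge> 1\<close>. The other varying terms
  are \<open>- t + 5 t^2 / 64\<close> with \<open>t = k^2 / a\<close>, which decreases in
  \<open>t\<close> on \<open>[0, 1]\<close>, while \<open>t\<close> falls as \<open>a\<close>
  grows.\<close>

lemma excess_min_strict_mono:
  assumes "\<bar>k\<bar> < 1" "1 \<le> a" "a < b"
  shows "excess_min k a < excess_min k b"
proof -
  define s t where "s = k\<^sup>2 / b" and "t = k\<^sup>2 / a"
  have "k\<^sup>2 \<le> 1" using assms by (simp add: abs_square_le_1)
  then have t: "t \<le> 1" "s \<le> t" "0 \<le> s"
    using assms mult_right_mono[of a b "k\<^sup>2"] by (auto simp: s_def t_def field_simps)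
  then have "0 \<le> (t - s) * (64 - 5 * s - 5 * t)" by (intro mult_nonneg_nonneg) linarith+
  then have "- t + 5 * t\<^sup>2 / 64 \<le> - s + 5 * s\<^sup>2 / 64" by (simp add: power2_eq_square algebra_simps)
  moreover have "0 < (b - a) * (b + a - 2)" using assms by (intro mult_pos_pos) linarith+
  then have "a\<^sup>2 - 2 * a < b\<^sup>2 - 2 * b" by (simp add: power2_eq_square algebra_simps)
  ultimately show ?thesis unfolding excess_min_def s_def[symmetric] t_def[symmetric] by linarith
qed

text \<open>At the critical energy \<open>a = 1 + r\<close> one has \<open>k^2 / a = 1 - r\<close>,
  and the value is \<open>- 27 (1 - r)^2 / 64\<close>. At \<open>a = 2\<close> the part
  \<open>4 a^2 - 8 a\<close> vanishes and the rest is nonnegative.\<close>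

lemma excess_min_root:
  assumes "0 < k" "k < 1"
  shows "\<exists>a > 1 + sqrt (1 - k\<^sup>2). excess_min k a = 0"
proof -
  define r where "r = sqrt (1 - k\<^sup>2)"
  have k2: "0 < k\<^sup>2" "k\<^sup>2 < 1" using assms by (auto simp: power_less_one_iff)
  have r2: "r\<^sup>2 = 1 - k\<^sup>2" using k2 by (simp add: r_def)
  have r: "0 < r" "r < 1" using k2 by (auto simp: r_def)
  have kr: "k\<^sup>2 = (1 - r) * (1 + r)" using r2 by (simp add: power2_eq_square algebra_simps)
  have t: "k\<^sup>2 / (1 + r) = 1 - r" using r unfolding kr by simp
  have "excess_min k (1 + r) = (1 - r) * (27 * (r - 1)) / 64"
    unfolding excess_min_def t unfolding kr by (simp add: power2_eq_square field_simps)
  also have "\<dots> < 0" using r by (simp add: mult_pos_neg)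
  finally have lo: "excess_min k (1 + r) < 0" .
  have "excess_min k 2 = 4 * k\<^sup>2 + 5 * (k\<^sup>2 / 2)\<^sup>2 / 64" by (simp add: excess_min_def)
  then have hi: "0 \<le> excess_min k 2" by simp
  have "\<exists>a\<ge>1 + r. a \<le> 2 \<and> excess_min k a = 0"
    by (rule IVT') (use lo hi r in \<open>auto simp: excess_min_def intro!: continuous_intros\<close>)
  then obtain a where "1 + r \<le> a" "excess_min k a = 0" by blast
  moreover have "a \<noteq> 1 + r" using lo calculation(2) by auto
  ultimately show ?thesis unfolding r_def[symmetric] by (intro exI[of _ a]) simp
qed

section \<open>Curvature of the Earth component\<close>

context subcritical
begin

definition grad :: "phase \<Rightarrow> phase" where
  "grad x = ((f1 (fst (fst x)), g1 (snd (fst x))), (4 * fst (snd x), 4 * snd (snd x)))"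

definition hess :: "phase \<Rightarrow> phase \<Rightarrow> phase" where
  "hess x v = ((f2 (fst (fst x)) * fst (fst v), g2 (snd (fst x)) * snd (fst v)), (4 * fst (snd v),
      4 * snd (snd v)))"

lemma f_deriv: "(f has_real_derivative f1 l) (at l)"
  unfolding f_def f1_def by (rule derivative_eq_intros refl)+ (simp add: algebra_simps)

lemma g_deriv: "(g has_real_derivative g1 n) (at n)"
  unfolding g_def g1_def by (rule derivative_eq_intros refl)+ (simp add: algebra_simps)

lemma f1_deriv: "(f1 has_real_derivative f2 l) (at l)"
proof -
  have "(f1 has_real_derivative 2 * cosh l * (a * cosh l - 1) + 2 * a * (sinh l)\<^sup>2) (at l)"
    unfolding f1_def by (rule derivative_eq_intros refl)+ (simp add: algebra_simps power2_eq_square)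
  moreover have "2 * cosh l * (a * cosh l - 1) + 2 * a * (sinh l)\<^sup>2 = f2 l"
    unfolding f2_def sinh_square_eq by (simp add: algebra_simps power2_eq_square)
  ultimately show ?thesis by simp
qed

lemma g1_deriv: "(g1 has_real_derivative g2 n) (at n)"
proof -
  have "(g1 has_real_derivative 2 * cos n * (a * cos n - k) - 2 * a * (sin n)\<^sup>2) (at n)"
    unfolding g1_def by (rule derivative_eq_intros refl)+ (simp add: algebra_simps power2_eq_square)
  moreover have "2 * cos n * (a * cos n - k) - 2 * a * (sin n)\<^sup>2 = g2 n"
    unfolding g2_def sin_squared_eq by (simp add: algebra_simps power2_eq_square)
  ultimately show ?thesis by simp
qed

lemma Q_grad: "GDERIV (regularized_Q \<mu> c) x :> grad x"
proof -
  have "((\<lambda>x :: phase. 2 * ((fst (snd x))\<^sup>2 + (snd (snd x))\<^sup>2) + f (fst (fst x)) + g (snd (fst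
      x))) has_derivative (\<lambda>h. h \<bullet> grad x)) (at x)"
    by (rule derivative_eq_intros DERIV_compose_FDERIV[OF f_deriv] DERIV_compose_FDERIV[OF
        g_deriv] refl)+
      (simp add: grad_def inner_prod_def fun_eq_iff algebra_simps)
  then show ?thesis unfolding gderiv_def Q_eq_proj[abs_def] .
qed

lemma grad_hess: "(grad has_derivative hess x) (at x)"
  unfolding grad_def hess_def
  by (rule derivative_eq_intros DERIV_compose_FDERIV[OF f1_deriv] DERIV_compose_FDERIV[OF
      g1_deriv] refl)+
    (simp add: fun_eq_iff algebra_simps)

text \<open>The factors \<open>a * cosh l - 1\<close> and \<open>a * cos n - k\<close> have no zero
  in the well, which leaves \<open>sinh l = 0\<close> and \<open>sin n = 0\<close>.\<close>

lemma grad_nonzero: assumes "x \<in> well" "x \<noteq> center" shows "grad x \<noteq> 0"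
proof
  assume g0: "grad x = 0"
  obtain l n pl pn where x: "x = ((l, n), (pl, pn))" by (metis surj_pair)
  have 0: "pl = 0" "pn = 0" "f1 l = 0" "g1 n = 0" using g0 by (auto simp: grad_def x zero_prod_def)
  have "a * cosh l > 1"
    using a_gt_1 cosh_real_ge_1[of l] mult_mono[of 1 a 1 "cosh l"] mult_strict_right_mono[of 1 a
        "cosh l"] by linarith
  then have "l = 0" using 0(3) by (simp add: f1_def)
  moreover have "n = pi"
  proof -
    have n: "0 < n" "n < 2 * pi" "a * cos n < k" using assms(1) by (auto simp: x well_iff)
    then have "sin n = 0" using 0(4) by (simp add: g1_def)
    then show ?thesis using n sin_gt_zero[of n] sin_lt_zero[of n]
      by (metis less_irrefl linorder_neqE_linordered_idom)
  qed
  ultimately show False using assms(2) 0 by (simp add: x center_def)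
qed

lemma surface_not_center: "x \<in> surface \<Longrightarrow> x \<noteq> center"
  using Q_center by (auto simp: surface_def)

lemma closed_hypersurface_surface: "closed_hypersurface surface"
proof -
  have bl: "blinfun_apply (Blinfun (hess x)) = hess x" for x
    using bounded_linear_Blinfun_apply has_derivative_bounded_linear[OF grad_hess] by blast
  have "C2_hypersurface surface"
    unfolding C2_hypersurface_def
  proof (intro ballI exI conjI)
    fix x assume x: "x \<in> surface"
    \<comment> \<open>One neighbourhood and one defining function serve all points.\<close>
    show "open (well - {center})" using well_open by (simp add: open_Diff)
    show "x \<in> well - {center}" using x surface_not_center by (auto simp: surface_def)
    show "surface \<inter> (well - {center}) = {y \<in> well - {center}. regularized_Q \<mu> c y = 0}"
      by (auto simp: surface_def)
    fix y assume y: "y \<in> well - {center}"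
    show "GDERIV (regularized_Q \<mu> c) y :> grad y" by (rule Q_grad)
    show "grad y \<noteq> 0" using grad_nonzero y by blast
    show "(grad has_derivative blinfun_apply (Blinfun (hess y))) (at y)" unfolding bl
      by (rule grad_hess)
  next
    have "continuous_on (well - {center}) (\<lambda>x. hess x v)" for v
      unfolding hess_def f2_def g2_def by (intro continuous_intros)
    then show "continuous_on (well - {center}) (\<lambda>x. Blinfun (hess x))"
      by (intro continuous_on_blinfun_componentwise) (simp add: bl)
  qed
  then show ?thesis
    unfolding closed_hypersurface_def using surface_nonempty surface_compact body_geometry(2)
      by blast
qed

lemma f2_pos: "0 < f2 l"
proof -
  define u where "u = cosh l"
  have u: "1 \<le> u" unfolding u_def by (rule cosh_real_ge_1)
  have "f2 l = 2 * (a * u * (u - 1)) + 2 * ((a - 1) * u) + 2 * (a * (u * u - 1))"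
    by (simp add: f2_def u_def power2_eq_square algebra_simps)
  moreover have "0 \<le> a * u * (u - 1)" "0 < (a - 1) * u" "0 \<le> a * (u * u - 1)"
    using u a_gt_1 mult_mono[of 1 u 1 u] by auto
  ultimately show ?thesis by linarith
qed

text \<open>This inequality makes \<open>l = 0\<close> the worst case for convexity.\<close>

lemma f1_square_le: "(f1 l)\<^sup>2 \<le> 2 * (f l - f 0) * f2 l"
proof -
  define u where "u = cosh l"
  have u: "1 \<le> u" unfolding u_def by (rule cosh_real_ge_1)
  have s: "(sinh l)\<^sup>2 = u\<^sup>2 - 1" by (simp add: sinh_square_eq u_def)
  have f1: "(f1 l)\<^sup>2 = 4 * (u\<^sup>2 - 1) * (a * u - 1)\<^sup>2"
    by (simp add: f1_def power_mult_distrib s) (simp add: u_def)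
  have "3 < a * u + 2 * a" using a_gt_1 u mult_mono[of 1 a 1 u] by linarith
  then have "0 \<le> a * u * (a * u + 2 * a - 3) + (a - 1)\<^sup>2"
    using a_gt_1 u by (intro add_nonneg_nonneg mult_nonneg_nonneg) auto
  \<comment> \<open>Both sides of the claim agree to leading order at \<open>l = 0\<close>, whence
    the double root at \<open>u = 1\<close>.\<close>
  then have "0 \<le> 4 * (u - 1)\<^sup>2 * (a * u * (a * u + 2 * a - 3) + (a - 1)\<^sup>2)" by simp
  also have "\<dots> = 2 * (f l - f 0) * f2 l - (f1 l)\<^sup>2"
    unfolding f1 f_0 f2_def f_def u_def[symmetric] by (simp add: power2_eq_square algebra_simps)
  finally show ?thesis by simp
qed

lemma excess_eq: "(g1 n)\<^sup>2 - 2 * (f 0 + g n) * g2 n = excess a k (- cos n)"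
proof -
  have "(g1 n)\<^sup>2 = 4 * (1 - (cos n)\<^sup>2) * (a * cos n - k)\<^sup>2"
    by (simp add: g1_def power_mult_distrib sin_squared_eq)
  then show ?thesis unfolding f_0 g_def g2_def excess_def
    by (simp add: power2_eq_square algebra_simps)
qed

lemma convex_surface:
  assumes crit: "0 < k \<Longrightarrow> 0 < excess_min k a"
  shows "strictly_convex_hypersurface surface"
proof (rule strictly_convex_hypersurface_if_hessian_positive[OF closed_hypersurface_surface
    interior_body_open body_geometry(3) _ body_geometry(1)])
  show "bounded interior_body"
    using body_compact interior_body_subset bounded_subset compact_imp_bounded by blast
  fix x assume xs: "x \<in> surface"
  show "regularized_Q \<mu> c x = 0" using xs by (simp add: surface_def)
  show "GDERIV (regularized_Q \<mu> c) x :> grad x" by (rule Q_grad)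
  show "grad x \<noteq> 0" using xs surface_not_center grad_nonzero by (auto simp: surface_def)
  show "(grad has_derivative hess x) (at x)" by (rule grad_hess)
  fix v assume v: "v \<noteq> 0" "grad x \<bullet> v = 0"
  obtain l n pl pn where x: "x = ((l, n), (pl, pn))" by (metis surj_pair)
  obtain vl vn Pl Pn where ve: "v = ((vl, vn), (Pl, Pn))" by (metis surj_pair)
  have n: "a * cos n < k" and Q: "2 * (pl\<^sup>2 + pn\<^sup>2) + f l + g n = 0"
    using xs by (simp_all add: surface_def x well_iff Q_eq)
  \<comment> \<open>On the surface \<open>A = 4 |p|^2 + 2 (f l - f 0)\<close>: the Cauchy-Schwarz
    weight after estimating \<open>f1^2 / f2\<close>, now a function of \<open>n\<close>
    alone.\<close>
  define A where "A = - 2 * (f 0 + g n)"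
  have A: "0 \<le> A" using Q f_mono[of 0 l] zero_le_power2[of pl] zero_le_power2[of pn]
    unfolding A_def distrib_left by linarith
  have "0 < excess a k (- cos n)"
  proof (rule excess_pos[OF k_less_a k_bound discriminant_pos _ _ _ crit])
    show "- k < a * - cos n" "- cos n \<le> 1" using n by simp_all
    have "0 \<le> - (f 0 + g n)" using A by (simp add: A_def)
    then show "0 \<le> a * (- cos n)\<^sup>2 + 2 * k * - cos n - a + 2" by (simp add: f_0 g_def)
  qed
  then have B: "0 < (g1 n)\<^sup>2 + A * g2 n" unfolding excess_eq[symmetric] A_def
    by (simp add: algebra_simps)
  define M where "M = 4 * (Pl\<^sup>2 + Pn\<^sup>2) + f2 l * vl\<^sup>2"
  have M0: "0 \<le> M" using f2_pos[of l] by (simp add: M_def)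
  have tan: "g1 n * vn = - (4 * (pl * Pl + pn * Pn) + f1 l * vl)"
    using v(2) by (simp add: x ve grad_def algebra_simps)
  have "(g1 n * vn)\<^sup>2 \<le> A * M"
  proof -
    define d where "d = 2 * (f l - f 0)"
    have d: "0 \<le> d" using f_mono[of 0 l] by (simp add: d_def)
    have A': "A = 4 * (pl\<^sup>2 + pn\<^sup>2) + d" using Q by (simp add: A_def d_def algebra_simps)
    have 1: "(pl * Pl + pn * Pn)\<^sup>2 \<le> (pl\<^sup>2 + pn\<^sup>2) * (Pl\<^sup>2 + Pn\<^sup>2)"
    proof -
      have "0 \<le> (pl * Pn - pn * Pl)\<^sup>2" by simp
      then show ?thesis by (simp add: power2_eq_square algebra_simps)
    qed
    have 2: "(f1 l)\<^sup>2 * vl\<^sup>2 \<le> d * (f2 l * vl\<^sup>2)"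
      using mult_right_mono[OF f1_square_le[of l], of "vl\<^sup>2"] by (simp add: d_def algebra_simps)
    have scale: "(4 * X)\<^sup>2 \<le> (4 * Y) * (4 * Z)" if "X\<^sup>2 \<le> Y * Z" for X Y Z :: real
      using that by (simp add: power_mult_distrib)
    \<comment> \<open>Cauchy-Schwarz with the products replaced by upper bounds, as \<open>1\<close>
      and \<open>2\<close> provide; the mixed term is handled by the arithmetic-geometric mean
      inequality.\<close>
    have cs: "(X + Y)\<^sup>2 \<le> (p + q) * (r + s)"
      if "X\<^sup>2 \<le> p * r" "Y\<^sup>2 \<le> q * s" "0 \<le> p" "0 \<le> q" "0 \<le> r" "0 \<le> s" for X Y p q r s :: real
    proof -
      have "X\<^sup>2 * Y\<^sup>2 \<le> (p * r) * (q * s)" using that by (intro mult_mono) auto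
      then have "4 * (X * Y)\<^sup>2 \<le> 4 * (p * s) * (q * r)"
        by (simp add: power_mult_distrib algebra_simps)
      also have "\<dots> \<le> (p * s + q * r)\<^sup>2"
        using zero_le_power2[of "p * s - q * r"] by (simp add: power2_eq_square algebra_simps)
      finally have "(2 * (X * Y))\<^sup>2 \<le> (p * s + q * r)\<^sup>2" by (simp add: power_mult_distrib)
      moreover have "0 \<le> p * s + q * r" using that by simp
      ultimately have "2 * (X * Y) \<le> p * s + q * r" by (rule power2_le_imp_le)
      then show ?thesis using that(1,2) by (simp add: power2_eq_square algebra_simps)
    qed
    have "(4 * (pl * Pl + pn * Pn) + f1 l * vl)\<^sup>2 \<le> (4 * (pl\<^sup>2 + pn\<^sup>2) + d) * (4 * (Pl\<^sup>2 + Pn\<^sup>2) +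
        f2 l * vl\<^sup>2)"
      by (rule cs) (use scale[OF 1] 2 d f2_pos[of l] in \<open>simp_all only: power_mult_distrib\<close>,
          simp_all)
    then show ?thesis unfolding tan A' M_def by (simp only: power2_minus)
  qed
  then have main: "(g1 n)\<^sup>2 * vn\<^sup>2 \<le> A * M" by (simp add: power_mult_distrib)
  have form: "hess x v \<bullet> v = M + g2 n * vn\<^sup>2"
    by (simp add: x ve hess_def M_def power2_eq_square algebra_simps)
  show "0 < hess x v \<bullet> v"
  \<comment> \<open>Contradiction avoids dividing by \<open>A\<close> or \<open>g1 n\<close>: the
    first vanishes at the edge of the Hill region, the second at \<open>n = pi\<close>.\<close>
  proof (rule ccontr)
    assume "\<not> 0 < hess x v \<bullet> v"
    then have neg: "M \<le> - (g2 n * vn\<^sup>2)" by (simp add: form)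
    then have "A * M \<le> - (A * (g2 n * vn\<^sup>2))" using mult_left_mono[OF neg A] by simp
    then have "((g1 n)\<^sup>2 + A * g2 n) * vn\<^sup>2 \<le> 0" using main by (simp add: algebra_simps)
    then have "vn = 0" using B by (simp add: mult_le_0_iff)
    then have "M = 0" using neg M0 by simp
    then have "4 * (Pl\<^sup>2 + Pn\<^sup>2) = 0 \<and> f2 l * vl\<^sup>2 = 0"
      unfolding M_def using f2_pos[of l] by (subst (asm) add_nonneg_eq_0_iff) auto
    moreover from this have "Pl\<^sup>2 + Pn\<^sup>2 = 0" unfolding distrib_left by linarith
    ultimately have "Pl\<^sup>2 + Pn\<^sup>2 = 0" and vl: "vl = 0" using f2_pos[of l] by simp_all
    then have "Pl = 0" "Pn = 0" by (simp_all only: sum_power2_eq_zero_iff)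
    then show False using v(1) \<open>vn = 0\<close> vl by (simp add: ve zero_prod_def)
  qed
qed

text \<open>Two curves through a point over \<open>l = 0\<close>, \<open>cos n = k / (4 a)\<close> have accelerations along the same
  axis: rotating the momentum bends the surface inward, while moving along \<open>n\<close> with
  \<open>p\<^sub>l = sqrt (h t)\<close> bends it the other way (or not at all) when \<open>excess_min k a \<le> 0\<close>.\<close>

lemma nonconvex_surface:
  assumes k: "0 < k" and crit: "excess_min k a \<le> 0"
  shows "\<not> strictly_convex_hypersurface surface"
proof
  assume "strictly_convex_hypersurface surface"
  then obtain N where N: "unit_normal_field surface N"
    and pos: "\<And>x v. x \<in> surface \<Longrightarrow> v \<in> tangent_space surface x \<Longrightarrow> v \<noteq> 0 \<Longrightarrow> 0 <
        second_fundamental_form N x v v"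
    unfolding strictly_convex_hypersurface_def by blast
  define n where "n = arccos (k / (4 * a))"
  have a0: "0 < a" using a_gt_1 by simp
  have ka: "0 \<le> k / (4 * a)" "k / (4 * a) \<le> 1" using k k_less_a a0 by (auto simp: field_simps)
  have cosn: "cos n = k / (4 * a)" unfolding n_def using ka by (intro cos_arccos) auto
  have n: "0 \<le> n" "n \<le> pi" unfolding n_def using ka by (auto intro: arccos_lbound arccos_ubound)
  have n0: "0 < n" using n cosn k_less_a a0 by (cases "n = 0") (auto simp: field_simps)
  \<comment> \<open>\<open>h t\<close> is the value of \<open>pl^2\<close> that puts a point with
    \<open>l = 0\<close>, \<open>pn = 0\<close> and angle \<open>n + t\<close> on the
    surface.\<close>
  define h where "h = (\<lambda>t. - (f 0 + g (n + t)) / 2)"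
  define I where "I = {t. 0 < n + t \<and> n + t < 2 * pi \<and> a * cos (n + t) < k \<and> 0 < h t}"
  have h_deriv: "(h has_real_derivative - g1 (n + t) / 2) (at t)" for t
  proof -
    have "((\<lambda>t. g (n + t)) has_real_derivative g1 (n + t)) (at t)"
      using g_deriv[of "n + t"] DERIV_shift[of g "g1 (n + t)" t n] by (simp add: add.commute)
    then show ?thesis unfolding h_def by (auto intro!: derivative_eq_intros)
  qed
  have h_cont: "continuous_on T h" for T
    unfolding h_def g_def by (intro continuous_intros) auto
  have I_open: "open I"
    unfolding I_def by (intro open_Collect_conj open_Collect_less continuous_intros h_cont)
  have ex: "(g1 n)\<^sup>2 - 2 * (f 0 + g n) * g2 n \<le> 0"
    unfolding excess_eq cosn using excess_at_min[of a k] a0 crit by simp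
  have g2n: "g2 n < 0"
  proof -
    have "g2 n = - (k\<^sup>2 / (4 * a) + 2 * a)"
      unfolding g2_def cosn using a0 by (simp add: field_simps power2_eq_square)
    moreover have "0 \<le> k\<^sup>2 / (4 * a)" using a0 by simp
    ultimately show ?thesis using a0 by linarith
  qed
  have g1n: "g1 n \<noteq> 0"
  proof -
    have "0 < sin n" using n n0 cosn ka by (intro sin_gt_zero) (auto simp: le_less)
    moreover have "a * cos n - k \<noteq> 0" unfolding cosn using a0 k by simp
    ultimately show ?thesis by (simp add: g1_def)
  qed
  \<comment> \<open>The chosen angle lies inside the Hill region: otherwise \<open>g2 n < 0\<close>
    would make the excess at least \<open>(g1 n)^2 > 0\<close>.\<close>
  have h0: "0 < h 0"
  proof (rule ccontr)
    assume "\<not> 0 < h 0"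
    then have "0 \<le> f 0 + g n" by (simp add: h_def)
    then have "(f 0 + g n) * g2 n \<le> 0" using g2n by (simp add: mult_nonneg_nonpos)
    moreover have "0 < (g1 n)\<^sup>2" using g1n by simp
    ultimately show False using ex by linarith
  qed
  have "n < 2 * pi" using n pi_gt_zero by linarith
  then have I0: "0 \<in> I" using n0 h0 a0 k by (simp add: I_def cosn)
  define r where "r = sqrt (h 0)"
  have r: "0 < r" "r\<^sup>2 = h 0" using h0 by (simp_all add: r_def)
  define p where "p = N ((0, n), (r, 0))"
  have x0: "((0, n), (r, 0)) \<in> surface"
    using I0 r by (simp add: I_def surface_def well_iff Q_eq h_def)
  have 1: "0 < - r * fst (snd p)"
  proof -
    define \<gamma> \<gamma>' :: "real \<Rightarrow> phase" where "\<gamma> = (\<lambda>t. ((0, n), (r * cos t, r * sin t)))"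
      and "\<gamma>' = (\<lambda>t. ((0, 0), (- r * sin t, r * cos t)))"
    have in_s: "\<gamma> t \<in> surface" for t
    proof -
      have "(r * cos t)\<^sup>2 + (r * sin t)\<^sup>2 = r\<^sup>2"
        by (simp add: power_mult_distrib flip: distrib_left)
      then show ?thesis using x0 by (simp add: surface_def well_iff Q_eq \<gamma>_def)
    qed
    have d: "(\<gamma> has_vector_derivative \<gamma>' t) (at t)" for t
      unfolding \<gamma>_def \<gamma>'_def has_vector_derivative_def
      by (auto intro!: derivative_eq_intros simp: fun_eq_iff zero_prod_def algebra_simps)
    have d': "(\<gamma>' has_vector_derivative ((0, 0), (- r, 0))) (at 0)"
      unfolding \<gamma>'_def has_vector_derivative_def
      by (auto intro!: derivative_eq_intros simp: fun_eq_iff zero_prod_def algebra_simps)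
    have "second_fundamental_form N (\<gamma> 0) (\<gamma>' 0) (\<gamma>' 0) = N (\<gamma> 0) \<bullet> ((0, 0), (- r, 0))"
      using second_fundamental_form_curve[OF N open_UNIV UNIV_I in_s d d'] .
    moreover have "0 < second_fundamental_form N (\<gamma> 0) (\<gamma>' 0) (\<gamma>' 0)"
      using has_vector_derivative_in_tangent_space[OF open_UNIV UNIV_I in_s d, of 0] r in_s
      by (intro pos) (auto simp: \<gamma>'_def zero_prod_def)
    ultimately show ?thesis by (simp add: \<gamma>_def p_def inner_prod_def mult.commute)
  qed
  have 2: "0 < fst (snd p) * - ((g1 n)\<^sup>2 - 2 * (f 0 + g n) * g2 n)"
  proof -
    define \<gamma> \<gamma>' :: "real \<Rightarrow> phase" where "\<gamma> = (\<lambda>t. ((0, n + t), (sqrt (h t), 0)))"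
      and "\<gamma>' = (\<lambda>t. ((0, 1), (- g1 (n + t) / (4 * sqrt (h t)), 0)))"
    \<comment> \<open>The second derivative of \<open>sqrt (h t)\<close> at 0. Since
      \<open>16 * r ^ 3\<close> is positive, its sign is opposite to that of the excess.\<close>
    define w where "w = - ((g1 n)\<^sup>2 - 2 * (f 0 + g n) * g2 n) / (16 * r ^ 3)"
    have in_s: "\<gamma> t \<in> surface" if "t \<in> I" for t
      using that by (simp add: I_def surface_def well_iff Q_eq \<gamma>_def) (simp add: h_def field_simps)
    have sq: "((\<lambda>t. sqrt (h t)) has_real_derivative - g1 (n + t) / (4 * sqrt (h t))) (at t)"
      if "t \<in> I" for t
    proof -
      have "((\<lambda>t. sqrt (h t)) has_real_derivative inverse (sqrt (h t)) / 2 * (- g1 (n + t) / 2))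
          (at t)"
        using that by (intro DERIV_chain2[OF DERIV_real_sqrt h_deriv]) (simp add: I_def)
      then show ?thesis by (simp add: field_simps)
    qed
    have vd: "((\<lambda>t. ((0, b t), (\<rho> t, 0)) :: phase) has_vector_derivative ((0, b'), (\<rho>', 0))) (at t)"
      if "(b has_real_derivative b') (at t)" "(\<rho> has_real_derivative \<rho>') (at t)" for b b' \<rho> \<rho>' t
      using that unfolding has_vector_derivative_def has_field_derivative_def
      by (auto intro!: derivative_eq_intros simp: fun_eq_iff zero_prod_def algebra_simps)
    have d: "(\<gamma> has_vector_derivative \<gamma>' t) (at t)" if "t \<in> I" for t
      unfolding \<gamma>_def \<gamma>'_def by (rule vd[OF _ sq[OF that]]) (auto intro!: derivative_eq_intros)
    have "((\<lambda>t. g1 (n + t)) has_real_derivative g2 n) (at 0)"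
      using g1_deriv[of n] DERIV_shift[of g1 "g2 n" 0 n] by (simp add: add.commute)
    from DERIV_divide[OF DERIV_minus[OF this] DERIV_cmult[OF sq[OF I0], of 4]]
    have "((\<lambda>t. - g1 (n + t) / (4 * sqrt (h t))) has_real_derivative
        ((- g2 n) * (4 * sqrt (h 0)) - (- g1 n) * (4 * (- g1 n / (4 * sqrt (h 0))))) / (4 * sqrt
            (h 0) * (4 * sqrt (h 0)))) (at 0)"
      using h0 by simp
    also have "((- g2 n) * (4 * sqrt (h 0)) - (- g1 n) * (4 * (- g1 n / (4 * sqrt (h 0))))) / (4 *
        sqrt (h 0) * (4 * sqrt (h 0))) = w"
    proof -
      have e: "f 0 + g n = - 2 * r\<^sup>2" using r by (simp add: h_def)
      show ?thesis unfolding w_def e r_def[symmetric] using r(1)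
        by (simp add: field_simps power2_eq_square power3_eq_cube)
    qed
    finally have "((\<lambda>t. - g1 (n + t) / (4 * sqrt (h t))) has_real_derivative w) (at 0)" .
    then have d': "(\<gamma>' has_vector_derivative ((0, 0), (w, 0))) (at 0)"
      unfolding \<gamma>'_def by (intro vd) (auto intro!: derivative_eq_intros)
    have "second_fundamental_form N (\<gamma> 0) (\<gamma>' 0) (\<gamma>' 0) = N (\<gamma> 0) \<bullet> ((0, 0), (w, 0))"
      using second_fundamental_form_curve[OF N I_open I0 in_s d d'] .
    moreover have "0 < second_fundamental_form N (\<gamma> 0) (\<gamma>' 0) (\<gamma>' 0)"
      using has_vector_derivative_in_tangent_space[OF I_open I0 in_s d[OF I0]] in_s[OF I0]
      by (intro pos) (auto simp: \<gamma>'_def zero_prod_def)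
    ultimately have "0 < fst (snd p) * w" by (simp add: \<gamma>_def p_def r_def inner_prod_def)
    then have "0 < fst (snd p) * (w * (16 * r ^ 3))"
      unfolding mult.assoc[symmetric] using r(1) by simp
    moreover have "w * (16 * r ^ 3) = - ((g1 n)\<^sup>2 - 2 * (f 0 + g n) * g2 n)"
      unfolding w_def using r(1) by simp
    ultimately show ?thesis by (simp only:)
  qed
  have "fst (snd p) < 0" using 1 r by (simp add: mult_less_0_iff)
  then show False using 2 ex mult_nonpos_nonneg[of "fst (snd p)" "- ((g1 n)\<^sup>2 - 2 * (f 0 + g n) *
      g2 n)"]
    by linarith
qed

end

theorem theorem1p1:
  fixes \<mu> :: real
  assumes "0 < \<mu>" "\<mu> < 1"
  shows "two_to_one_mod_2pi elliptic_domain noncollision elliptic_coords \<and>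
    symplectic_on elliptic_domain elliptic_coords \<and>
    (\<forall>c < critical_energy \<mu>.
       wrap ` regularized_earth_component \<mu> c = earth_component_cylinder \<mu> c \<and>
       closed_hypersurface (regularized_earth_component \<mu> c)) \<and>
    (1/2 \<le> \<mu> \<longrightarrow>
       (\<forall>c < critical_energy \<mu>.
          strictly_convex_hypersurface (regularized_earth_component \<mu> c))) \<and>
    (\<mu> < 1/2 \<longrightarrow>
       (\<exists>c\<^sub>0 < critical_energy \<mu>.
          (\<forall>c < c\<^sub>0. strictly_convex_hypersurface (regularized_earth_component \<mu> c)) \<and>
          (\<forall>c. c\<^sub>0 \<le> c \<and> c < critical_energy \<mu> \<longrightarrow>
             \<not> strictly_convex_hypersurface (regularized_earth_component \<mu> c))))"
proof (intro conjI allI impI)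
  show "two_to_one_mod_2pi elliptic_domain noncollision elliptic_coords"
    by (rule elliptic_two_to_one)
  show "symplectic_on elliptic_domain elliptic_coords" by (rule elliptic_coords_symplectic)
  have sub: "subcritical \<mu> c" if "c < critical_energy \<mu>" for c
    using assms that by unfold_locales
  {
    fix c assume "c < critical_energy \<mu>"
    then interpret subcritical \<mu> c by (rule sub)
    show "wrap ` regularized_earth_component \<mu> c = earth_component_cylinder \<mu> c"
      by (simp add: regularized_earth_component_eq earth_component_cylinder_eq)
    show "closed_hypersurface (regularized_earth_component \<mu> c)"
      unfolding regularized_earth_component_eq by (rule closed_hypersurface_surface)
    assume "1/2 \<le> \<mu>"
    then show "strictly_convex_hypersurface (regularized_earth_component \<mu> c)"
      unfolding regularized_earth_component_eq by (intro convex_surface) (simp add: k_def)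
  }
  assume mu: "\<mu> < 1/2"
  define \<kappa> where "\<kappa> = 1 - 2 * \<mu>"
  have k: "0 < \<kappa>" "\<kappa> < 1" "\<bar>\<kappa>\<bar> < 1" using mu assms by (auto simp: \<kappa>_def)
  obtain a\<^sub>0 where a0: "1 + sqrt (1 - \<kappa>\<^sup>2) < a\<^sub>0" "excess_min \<kappa> a\<^sub>0 = 0" using excess_min_root k
    by blast
  \<comment> \<open>The formula does not involve the energy, so any subcritical value can
    instantiate the locale.\<close>
  have crit: "critical_energy \<mu> = - (1 + sqrt (1 - \<kappa>\<^sup>2))"
    using subcritical.critical_energy_eq[OF sub, of "critical_energy \<mu> - 1"] subcritical.k_def[OF
        sub, of "critical_energy \<mu> - 1"]
    by (simp add: \<kappa>_def)
  have "0 \<le> sqrt (1 - \<kappa>\<^sup>2)" using k by (simp add: abs_square_le_1)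
  then have a01: "1 \<le> a\<^sub>0" using a0 by linarith
  show "\<exists>c\<^sub>0 < critical_energy \<mu>.
          (\<forall>c < c\<^sub>0. strictly_convex_hypersurface (regularized_earth_component \<mu> c)) \<and>
          (\<forall>c. c\<^sub>0 \<le> c \<and> c < critical_energy \<mu> \<longrightarrow>
             \<not> strictly_convex_hypersurface (regularized_earth_component \<mu> c))"
  proof (intro exI conjI allI impI)
    \<comment> \<open>The threshold energy is minus the root of
      \<open>excess_min \<kappa>\<close>.\<close>
    show lt: "- a\<^sub>0 < critical_energy \<mu>" using a0 crit by simp
    fix c assume c: "c < - a\<^sub>0"
    then interpret subcritical \<mu> c using lt by (intro sub) simp
    have "0 < excess_min \<kappa> a" using excess_min_strict_mono[OF k(3) a01, of a] c a0
      by (simp add: a_def)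
    then show "strictly_convex_hypersurface (regularized_earth_component \<mu> c)"
      unfolding regularized_earth_component_eq by (intro convex_surface) (simp add: k_def \<kappa>_def)
  next
    fix c assume c: "- a\<^sub>0 \<le> c \<and> c < critical_energy \<mu>"
    then interpret subcritical \<mu> c by (intro sub) simp
    have "excess_min \<kappa> a \<le> 0"
      using excess_min_strict_mono[OF k(3), of a a\<^sub>0] c a0 a_gt_1
        by (cases "a = a\<^sub>0") (auto simp: a_def)
    then show "\<not> strictly_convex_hypersurface (regularized_earth_component \<mu> c)"
      unfolding regularized_earth_component_eq using k(1)
        by (intro nonconvex_surface) (simp_all add: k_def \<kappa>_def)
  qed
qed

end
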